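(* Let $W$ be a simply laced Weyl group of finite type, and let $X$ be a $W$-orbit of (unordered) pairs of orthogonal positive roots. The orbit contains a maximum element $\{\alpha,\beta\}$ with respect to $\le_2$. In particular, if $\alpha\vee\beta=\sum_{b\in\mathcal{B}}\mu_b b$ and $\alpha'\vee\beta'=\sum_{b\in\mathcal{B}}\lambda_b b$ for some other element $\{\alpha',\beta'\}$ in the orbit, then $\lambda_b\le\mu_b$ for all $b\in\mathcal{B}$.
   Context: $W$ is the Weyl group of a Dynkin diagram $\Gamma$ of type $A_n$, $D_n$ ($n\ge4$), $E_6$, $E_7$ or $E_8$, with simple roots $\Pi=\{\alpha_1,\dots,\alpha_n\}$, a basis of the real reflection representation $V$, and $W$-invariant form $B$ with $B(\alpha_i,\alpha_i)=2$, $B(\alpha_i,\alpha_j)=-1$ for adjacent $i,j$, and $0$ otherwise; the simple reflection $s_i$ acts by $s_i(v)=v-B(\alpha_i,v)\alpha_i$. $\Phi_+$ is the set of positive roots; $\alpha,\beta$ are orthogonal if $B(\alpha,\beta)=0$. Put $\alpha\vee\beta=\alpha\otimes\beta+\beta\otimes\alpha$. Action on pairs. $W$ acts on unordered pairs $\rho=\{\alpha,\beta\}$ of orthogonal positive roots by $w(\rho)=\Phi_+\cap\{\pm w(\alpha),\pm w(\beta)\}$. Canonical basis $\mathcal{B}$. The highest root of type $D_m$ ($m\ge4$) is the sum of the simple roots with coefficient $1$ at the endpoints of the diagram and $2$ at all other vertices. A positive root $\beta$ is elementary with respect to a simple root $\alpha_i$ if: (1) $\beta=\alpha_j$ is simple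 with $j\neq i$ not adjacent to $i$; or (2) $\beta=\alpha_h+\alpha_i+\alpha_j$ for a path $h$--$i$--$j$ in $\Gamma$; or (3) $\Gamma$ has a branch vertex, $i$ is not that vertex, and $\beta=\theta_i$ is the highest root of the standard parabolic subsystem of type $D_m$ ($m\ge4$) whose simple roots are those on the path from $i$ to the branch vertex together with all neighbours of the branch vertex. $\mathcal{B}$ is the set of all $\alpha_i\vee\beta$ with $\alpha_i\in\Pi$ and $\beta$ elementary with respect to $\alpha_i$ (in type $A_n$ only (1) and (2) occur). It is linearly independent and every 2-root $\alpha\vee\beta$ ($\alpha,\beta$ orthogonal roots) lies in $\mathbb{Z}\mathcal{B}$. Order $\le_2$. For $q_1,q_2\in\mathbb{Z}\mathcal{B}$, $q_1\le_2q_2$ if $q_2-q_1$ is a linear combination of elements of $\mathcal{B}$ with nonnegative coefficients. For pairs of orthogonal positive roots, $\{\alpha_1,\beta_1\}\le_2\{\alpha_2,\beta_2\}$ means $\alpha_1\vee\beta_1\le_2\alpha_2\vee\beta_2$. *)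

theory Defs
  imports "HOL-Analysis.Analysis"
begin

text \<open>
  A simply laced Dynkin diagram is given by an adjacency relation \<open>adj\<close> on a finite type
  \<open>'n\<close> of vertices. The reflection representation \<open>V\<close> is \<open>real ^ 'n\<close>, written in
  coordinates with respect to the basis of simple roots.
\<close>

type_synonym 'n graph = "'n \<Rightarrow> 'n \<Rightarrow> bool"

definition diagram_A :: "nat graph" where
  "diagram_A i j \<longleftrightarrow> j = i + 1 \<or> i = j + 1"

text \<open>Vertices \<open>1, \<dots>, n\<close>: the path \<open>1 - 2 - \<dots> - (n - 1)\<close>, with \<open>n\<close> attached to \<open>n - 2\<close>.\<close>

definition diagram_D :: "nat \<Rightarrow> nat graph" where
  "diagram_D n i j \<longleftrightarrow>
     (i \<le> n - 1 \<and> j \<le> n - 1 \<and> (j = i + 1 \<or> i = j + 1)) \<or> {i, j} = {n - 2, n}"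

text \<open>Bourbaki's labelling: the path \<open>1 - 3 - 4 - 5 - \<dots> - n\<close>, with \<open>2\<close> attached to \<open>4\<close>.\<close>

definition diagram_E :: "nat graph" where
  "diagram_E i j \<longleftrightarrow>
     {i, j} = {1, 3} \<or> {i, j} = {2, 4} \<or> (3 \<le> i \<and> 3 \<le> j \<and> (j = i + 1 \<or> i = j + 1))"

definition labelled_as :: "'n::finite graph \<Rightarrow> nat graph \<Rightarrow> bool" where
  "labelled_as adj G \<longleftrightarrow>
     (\<exists>f. bij_betw f UNIV {1..CARD('n)} \<and> (\<forall>i j. adj i j \<longleftrightarrow> G (f i) (f j)))"

definition simply_laced_dynkin :: "'n::finite graph \<Rightarrow> bool" where
  "simply_laced_dynkin adj \<longleftrightarrow>
     labelled_as adj diagram_A \<or>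
     (4 \<le> CARD('n) \<and> labelled_as adj (diagram_D CARD('n))) \<or>
     (CARD('n) \<in> {6, 7, 8} \<and> labelled_as adj diagram_E)"

definition simple_root :: "'n::finite \<Rightarrow> real ^ 'n" where
  "simple_root i = axis i 1"

definition cartan :: "'n::finite graph \<Rightarrow> 'n \<Rightarrow> 'n \<Rightarrow> real" where
  "cartan adj i j = (if i = j then 2 else if adj i j then -1 else 0)"

definition form :: "'n::finite graph \<Rightarrow> real ^ 'n \<Rightarrow> real ^ 'n \<Rightarrow> real" where
  "form adj v w = (\<Sum>i\<in>UNIV. \<Sum>j\<in>UNIV. v $ i * w $ j * cartan adj i j)"

definition simple_reflection :: "'n::finite graph \<Rightarrow> 'n \<Rightarrow> real ^ 'n \<Rightarrow> real ^ 'n" where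
  "simple_reflection adj i v = v - form adj (simple_root i) v *\<^sub>R simple_root i"

text \<open>Simple reflections are involutions, so the monoid they generate is the group.\<close>

inductive_set weyl_group :: "'n::finite graph \<Rightarrow> (real ^ 'n \<Rightarrow> real ^ 'n) set"
  for adj :: "'n graph" where
  one: "id \<in> weyl_group adj"
| step: "w \<in> weyl_group adj \<Longrightarrow> simple_reflection adj i \<circ> w \<in> weyl_group adj"

definition roots :: "'n::finite graph \<Rightarrow> (real ^ 'n) set" where
  "roots adj = {w (simple_root i) | w i. w \<in> weyl_group adj}"

definition pos_roots :: "'n::finite graph \<Rightarrow> (real ^ 'n) set" where
  "pos_roots adj = {\<alpha> \<in> roots adj. \<forall>i. 0 \<le> \<alpha> $ i}"

definition orth_pairs :: "'n::finite graph \<Rightarrow> (real ^ 'n) set set" where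
  "orth_pairs adj =
     {{\<alpha>, \<beta>} | \<alpha> \<beta>. \<alpha> \<in> pos_roots adj \<and> \<beta> \<in> pos_roots adj \<and> form adj \<alpha> \<beta> = 0}"

definition pair_act ::
  "'n::finite graph \<Rightarrow> (real ^ 'n \<Rightarrow> real ^ 'n) \<Rightarrow> (real ^ 'n) set \<Rightarrow> (real ^ 'n) set" where
  "pair_act adj w \<rho> = pos_roots adj \<inter> (w ` \<rho> \<union> uminus ` w ` \<rho>)"

definition pair_orbits :: "'n::finite graph \<Rightarrow> (real ^ 'n) set set set" where
  "pair_orbits adj = {(\<lambda>w. pair_act adj w \<rho>) ` weyl_group adj | \<rho>. \<rho> \<in> orth_pairs adj}"

text \<open>
  \<open>V \<otimes> V\<close> is the space of square matrices: the entry in position \<open>(i, j)\<close> is the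
  coefficient of the tensor product of the simple roots at \<open>i\<close> and \<open>j\<close>.
\<close>

definition tensor :: "real ^ 'n::finite \<Rightarrow> real ^ 'n \<Rightarrow> real ^ 'n ^ 'n" where
  "tensor v w = (\<chi> i j. v $ i * w $ j)"

definition vee :: "real ^ 'n::finite \<Rightarrow> real ^ 'n \<Rightarrow> real ^ 'n ^ 'n" (infixl "\<or>\<^sub>2" 70) where
  "v \<or>\<^sub>2 w = tensor v w + tensor w v"

definition neighbours :: "'n::finite graph \<Rightarrow> 'n \<Rightarrow> 'n set" where
  "neighbours adj i = {j. adj i j}"

definition branch_vertex :: "'n::finite graph \<Rightarrow> 'n \<Rightarrow> bool" where
  "branch_vertex adj c \<longleftrightarrow> 3 \<le> card (neighbours adj c)"

definition simple_path :: "'n::finite graph \<Rightarrow> 'n \<Rightarrow> 'n \<Rightarrow> 'n list \<Rightarrow> bool" where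
  "simple_path adj i j p \<longleftrightarrow>
     p \<noteq> [] \<and> hd p = i \<and> last p = j \<and> distinct p \<and> successively adj p"

text \<open>
  For \<open>S\<close> spanning a subdiagram of type \<open>D\<^sub>m\<close> with \<open>m \<ge> 4\<close>, this is the highest root of the
  corresponding standard parabolic subsystem; the endpoints of the subdiagram are the vertices
  with exactly one neighbour in \<open>S\<close>.
\<close>

definition highest_root_D :: "'n::finite graph \<Rightarrow> 'n set \<Rightarrow> real ^ 'n" where
  "highest_root_D adj S =
     (\<Sum>k\<in>S. (if card (neighbours adj k \<inter> S) = 1 then 1 else 2) *\<^sub>R simple_root k)"

inductive elementary :: "'n::finite graph \<Rightarrow> 'n \<Rightarrow> real ^ 'n \<Rightarrow> bool"
  for adj :: "'n graph" and i :: 'n where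
  simple: "j \<noteq> i \<Longrightarrow> \<not> adj i j \<Longrightarrow> elementary adj i (simple_root j)"
| path: "adj h i \<Longrightarrow> adj i j \<Longrightarrow> h \<noteq> j \<Longrightarrow>
    elementary adj i (simple_root h + simple_root i + simple_root j)"
| branch: "branch_vertex adj c \<Longrightarrow> i \<noteq> c \<Longrightarrow> simple_path adj i c p \<Longrightarrow>
    elementary adj i (highest_root_D adj (set p \<union> neighbours adj c))"

definition canonical_basis :: "'n::finite graph \<Rightarrow> (real ^ 'n ^ 'n) set" where
  "canonical_basis adj = {simple_root i \<or>\<^sub>2 \<beta> | i \<beta>. elementary adj i \<beta>}"

definition canonical_lattice :: "'n::finite graph \<Rightarrow> (real ^ 'n ^ 'n) set" where
  "canonical_lattice adj =
     {\<Sum>b\<in>canonical_basis adj. of_int (c b) *\<^sub>R b | c :: real ^ 'n ^ 'n \<Rightarrow> int. True}"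

definition le2 :: "'n::finite graph \<Rightarrow> real ^ 'n ^ 'n \<Rightarrow> real ^ 'n ^ 'n \<Rightarrow> bool" where
  "le2 adj q1 q2 \<longleftrightarrow>
     q1 \<in> canonical_lattice adj \<and> q2 \<in> canonical_lattice adj \<and>
     (\<exists>c. (\<forall>b\<in>canonical_basis adj. 0 \<le> c b) \<and>
          q2 - q1 = (\<Sum>b\<in>canonical_basis adj. c b *\<^sub>R b))"

text \<open>Independent of how the elements of the pairs are named, as \<open>\<or>\<^sub>2\<close> is commutative.\<close>

definition pair_le2 :: "'n::finite graph \<Rightarrow> (real ^ 'n) set \<Rightarrow> (real ^ 'n) set \<Rightarrow> bool" where
  "pair_le2 adj \<rho>1 \<rho>2 \<longleftrightarrow>
     (\<exists>\<alpha>1 \<beta>1 \<alpha>2 \<beta>2. \<rho>1 = {\<alpha>1, \<beta>1} \<and> \<rho>2 = {\<alpha>2, \<beta>2} \<and> le2 adj (\<alpha>1 \<or>\<^sub>2 \<beta>1) (\<alpha>2 \<or>\<^sub>2 \<beta>2))"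

end

theory Submission
  imports Defs
begin

text \<open>
  Unless \<open>\<alpha>\<^sub>i\<close> belongs to a pair of orthogonal positive roots, or is orthogonal to both of them,
  the reflection \<open>s\<^sub>i\<close> moves the 2-root of the pair by a 2-root \<open>\<alpha>\<^sub>i \<or> \<eta>\<close>, where \<open>\<eta>\<close> is a root
  orthogonal to \<open>\<alpha>\<^sub>i\<close> (\<open>vee_reflection\<close>, \<open>shift_R\<close>). As \<open>\<eta>\<close> is positive or negative, everything
  rests on one positivity statement: a positive root orthogonal to \<open>\<alpha>\<^sub>i\<close> is a nonnegative
  integral combination of the roots that are elementary with respect to \<open>\<alpha>\<^sub>i\<close>
  (\<open>orthogonal_root_in_cone\<close>). Then each such reflection raises or lowers the pair, and every pair
  lies below a pair in its orbit that no reflection raises. The theorem follows once such a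
  locally maximal pair is known to be unique in its orbit.

  Uniqueness is a short argument that is the same for all types. If \<open>\<alpha>\<^sub>i\<close> is negative on one
  member of a locally maximal pair \<open>{\<alpha>, \<beta>}\<close>, it is positive on the other, so \<open>\<alpha> + \<beta>\<close> is dominant.
  Neither member is dominant itself, and comparing the inequalities at a simple root negative on
  \<open>\<alpha>\<close> and one negative on \<open>\<beta>\<close> gives \<open>\<alpha> - \<beta> = \<alpha>\<^sub>j - \<alpha>\<^sub>i\<close> (\<open>locally_maximal_difference\<close>). Hence
  \<open>\<alpha> + \<beta>\<close> has odd coefficients exactly at \<open>i\<close> and \<open>j\<close>, and it determines the pair. Finally the
  sums of all pairs of an orbit are conjugate, since reflections in the two roots change signs,
  and a \<open>W\<close>-orbit of lattice vectors contains only one dominant vector (\<open>dominant_unique\<close>).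

  Positivity and independence of the canonical basis are also treated uniformly. A diagram of
  type \<open>A\<close>, \<open>D\<close> or \<open>E\<close> is a star with at most three arms, and in terms of the slopes of a vector
  along the arms the form is a sum of products of slopes, corrected at the centre
  (\<open>form_slopes\<close>). For a positive root \<open>\<beta>\<close> orthogonal to \<open>\<alpha>\<^sub>i\<close>, the slope \<open>t\<close> at \<open>i\<close> is the
  multiplicity of the \<open>D\<close>-type highest root \<open>\<theta>\<^sub>i\<close>; the products of \<open>\<beta>\<close> with suitable segments
  of an arm are at most one in absolute value, which forces the remaining coefficients of \<open>\<beta>\<close> to be large enough to subtract
  \<open>t \<theta>\<^sub>i\<close>. Conversely, partial sums of products of slopes define linear functionals on
  \<open>V \<otimes> V\<close> which, combined with matrix entries, separate the basis elements (\<open>dual_functional\<close>).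
\<close>

section \<open>The bilinear form\<close>

lemma form_add_left: "form adj (x + y) z = form adj x z + form adj y z"
  by (simp add: form_def algebra_simps sum.distrib)

lemma form_add_right: "form adj x (y + z) = form adj x y + form adj x z"
  by (simp add: form_def algebra_simps sum.distrib)

lemma form_scaleR_left: "form adj (c *\<^sub>R x) y = c * form adj x y"
  by (simp add: form_def sum_distrib_left mult.assoc)

lemma form_scaleR_right: "form adj x (c *\<^sub>R y) = c * form adj x y"
  by (simp add: form_def sum_distrib_left mult_ac)

lemma form_minus_left: "form adj (- x) y = - form adj x y"
  using form_scaleR_left[of adj "-1" x y] by simp

lemma form_minus_right: "form adj x (- y) = - form adj x y"
  using form_scaleR_right[of adj x "-1" y] by simp

lemma form_diff_left: "form adj (x - y) z = form adj x z - form adj y z"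
  using form_add_left[of adj x "- y" z] by (simp add: form_minus_left)

lemma form_diff_right: "form adj x (y - z) = form adj x y - form adj x z"
  using form_add_right[of adj x y "- z"] by (simp add: form_minus_right)

lemma form_zero_left: "form adj 0 y = 0"
  by (simp add: form_def)

lemma form_zero_right: "form adj x 0 = 0"
  by (simp add: form_def)

lemmas form_linear = form_add_left form_add_right form_scaleR_left form_scaleR_right
  form_minus_left form_minus_right form_diff_left form_diff_right form_zero_left form_zero_right

lemma form_sum_left: "form adj (\<Sum>k\<in>A. f k) y = (\<Sum>k\<in>A. form adj (f k) y)"
  by (induction A rule: infinite_finite_induct) (simp_all add: form_linear)

lemma simple_root_nth: "simple_root i $ k = (if k = i then 1 else 0)"
  by (simp add: simple_root_def axis_def)

lemma simple_root_expansion: "x = (\<Sum>k\<in>UNIV. (x $ k) *\<^sub>R simple_root k)"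
  by (simp add: vec_eq_iff simple_root_nth if_distrib[where f="\<lambda>t. _ * t"] cong: if_cong)

lemma form_expand_left: "form adj x y = (\<Sum>k\<in>UNIV. x $ k * form adj (simple_root k) y)"
  by (subst (1) simple_root_expansion[of x]) (simp add: form_sum_left form_linear)

lemma form_simple_left: "form adj (simple_root i) y = (\<Sum>k\<in>UNIV. cartan adj i k * y $ k)"
proof -
  have "form adj (simple_root i) y
      = (\<Sum>j\<in>UNIV. if j = i then \<Sum>k\<in>UNIV. cartan adj i k * y $ k else 0)"
    unfolding form_def by (intro sum.cong) (auto simp: simple_root_nth mult_ac)
  then show ?thesis by simp
qed

lemma form_simple_neighbours:
  assumes "\<not> adj i i"
  shows "form adj (simple_root i) y = 2 * y $ i - (\<Sum>k\<in>neighbours adj i. y $ k)"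
proof -
  have "form adj (simple_root i) y
      = (\<Sum>k\<in>UNIV. (if k = i then 2 * y $ i else 0) - (if k \<in> neighbours adj i then y $ k else 0))"
    unfolding form_simple_left using assms
    by (intro sum.cong) (auto simp: cartan_def neighbours_def)
  then show ?thesis by (simp add: sum_subtractf sum.If_cases)
qed

lemma form_simple_simple: "form adj (simple_root i) (simple_root j) = cartan adj i j"
proof -
  have "(\<Sum>k\<in>UNIV. cartan adj i k * simple_root j $ k)
      = (\<Sum>k\<in>UNIV. if k = j then cartan adj i k else 0)"
    by (intro sum.cong) (auto simp: simple_root_nth)
  then show ?thesis by (simp add: form_simple_left)
qed

lemma vee_commute: "x \<or>\<^sub>2 y = y \<or>\<^sub>2 x"
  by (simp add: vee_def add.commute)

lemma vee_nth: "(x \<or>\<^sub>2 y) $ i $ j = x $ i * y $ j + y $ i * x $ j"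
  by (simp add: vee_def tensor_def)

lemma vee_add_right: "x \<or>\<^sub>2 (y + z) = x \<or>\<^sub>2 y + x \<or>\<^sub>2 z"
  by (simp add: vec_eq_iff vee_nth algebra_simps)

lemma vee_minus_right: "x \<or>\<^sub>2 (- y) = - (x \<or>\<^sub>2 y)"
  by (simp add: vec_eq_iff vee_nth algebra_simps)

lemma vee_zero_right: "x \<or>\<^sub>2 0 = 0"
  by (simp add: vec_eq_iff vee_nth)

definition height :: "real ^ 'n::finite \<Rightarrow> real" where
  "height x = (\<Sum>i\<in>UNIV. x $ i)"

lemma height_diff: "height (x - y) = height x - height y"
  and height_scaleR: "height (c *\<^sub>R x) = c * height x"
  by (simp_all add: height_def sum.distrib sum_subtractf sum_distrib_left)

lemma height_simple_root [simp]: "height (simple_root i) = 1"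
  by (simp add: height_def simple_root_nth)

lemma height_pos:
  assumes "0 \<le> x" "x \<noteq> 0"
  shows "0 < height x"
proof -
  obtain k where "x $ k \<noteq> 0" using assms(2) by (auto simp: vec_eq_iff)
  then have "0 < x $ k" using assms(1) by (metis less_eq_vec_def order_le_less zero_index)
  then show ?thesis unfolding height_def
    using assms(1) by (intro sum_pos2[of _ k]) (auto simp: less_eq_vec_def)
qed

definition lattice_vec :: "real ^ 'n::finite \<Rightarrow> bool" where
  "lattice_vec x \<longleftrightarrow> (\<forall>i. x $ i \<in> \<int>)"

lemma lattice_vec_simple_root [simp]: "lattice_vec (simple_root i)"
  by (simp add: lattice_vec_def simple_root_nth)

lemma lattice_vec_add: "lattice_vec x \<Longrightarrow> lattice_vec y \<Longrightarrow> lattice_vec (x + y)"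
  and lattice_vec_diff: "lattice_vec x \<Longrightarrow> lattice_vec y \<Longrightarrow> lattice_vec (x - y)"
  and lattice_vec_minus: "lattice_vec x \<Longrightarrow> lattice_vec (- x)"
  and lattice_vec_scaleR: "c \<in> \<int> \<Longrightarrow> lattice_vec x \<Longrightarrow> lattice_vec (c *\<^sub>R x)"
  by (simp_all add: lattice_vec_def)

lemma Ints_form:
  assumes "lattice_vec x" "lattice_vec y"
  shows "form adj x y \<in> \<int>"
  using assms unfolding form_def lattice_vec_def cartan_def
  by (intro Ints_sum Ints_mult) auto

lemma finite_bounded_lattice: "finite {x :: real ^ 'n::finite. lattice_vec x \<and> (\<forall>i. \<bar>x $ i\<bar> \<le> K)}"
  (is "finite ?A")
proof -
  let ?f = "\<lambda>x :: real ^ 'n. \<lambda>i. \<lfloor>x $ i\<rfloor>"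
  have inj: "inj_on ?f ?A"
  proof (rule inj_onI)
    fix x y assume xy: "x \<in> ?A" "y \<in> ?A" "?f x = ?f y"
    have "x $ i = y $ i" for i
    proof -
      have "x $ i \<in> \<int>" "y $ i \<in> \<int>" "\<lfloor>x $ i\<rfloor> = \<lfloor>y $ i\<rfloor>"
        using xy by (auto simp: lattice_vec_def dest: fun_cong)
      then show ?thesis by (metis of_int_floor)
    qed
    then show "x = y" by (simp add: vec_eq_iff)
  qed
  have "?f ` ?A \<subseteq> (\<Pi>\<^sub>E i\<in>UNIV. {- \<lceil>\<bar>K\<bar>\<rceil> .. \<lceil>\<bar>K\<bar>\<rceil>})"
  proof (rule image_subsetI, rule PiE_I)
    fix x :: "real ^ 'n" and i assume "x \<in> ?A"
    then have "\<bar>x $ i\<bar> \<le> K" by blast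
    then show "\<lfloor>x $ i\<rfloor> \<in> {- \<lceil>\<bar>K\<bar>\<rceil> .. \<lceil>\<bar>K\<bar>\<rceil>}" unfolding atLeastAtMost_iff by linarith
  qed simp
  then have "finite (?f ` ?A)"
    by (rule finite_subset) (intro finite_PiE finite finite_atLeastAtMost_int)
  then show ?thesis using inj by (rule finite_imageD)
qed

section \<open>Root vectors of a positive definite diagram\<close>

locale positive_diagram =
  fixes adj :: "'n::finite graph"
  assumes adj_sym: "adj i j \<Longrightarrow> adj j i"
    and adj_irrefl: "\<not> adj i i"
    and connected: "i \<in> A \<Longrightarrow> (\<And>j k. j \<in> A \<Longrightarrow> adj j k \<Longrightarrow> k \<in> A) \<Longrightarrow> A = UNIV"
    and form_pos: "x \<noteq> 0 \<Longrightarrow> 0 < form adj x x"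
begin

abbreviation B :: "real ^ 'n \<Rightarrow> real ^ 'n \<Rightarrow> real" where
  "B \<equiv> form adj"

abbreviation s :: "'n \<Rightarrow> real ^ 'n \<Rightarrow> real ^ 'n" where
  "s \<equiv> simple_reflection adj"

lemma cartan_sym: "cartan adj i j = cartan adj j i"
  using adj_sym by (auto simp: cartan_def)

lemma B_sym: "B x y = B y x"
  unfolding form_def by (subst sum.swap) (simp add: cartan_sym mult_ac)

lemma B_simple_self [simp]: "B (simple_root i) (simple_root i) = 2"
  by (simp add: form_simple_simple cartan_def)

lemma B_dominant_mono:
  assumes "\<And>k. 0 \<le> B (simple_root k) y" "0 \<le> x"
  shows "0 \<le> B x y"
  unfolding form_expand_left[of adj x y] using assms
  by (intro sum_nonneg mult_nonneg_nonneg) (auto simp: less_eq_vec_def)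

lemma even_norm:
  assumes "lattice_vec x"
  shows "B x x / 2 \<in> \<int>"
proof -
  have "B (\<Sum>k\<in>F. (x $ k) *\<^sub>R simple_root k) (\<Sum>k\<in>F. (x $ k) *\<^sub>R simple_root k) / 2 \<in> \<int>
     \<and> lattice_vec (\<Sum>k\<in>F. (x $ k) *\<^sub>R simple_root k)" if "finite F" for F
    using that
  proof (induction F)
    case empty
    show ?case by (simp add: form_linear lattice_vec_def)
  next
    case (insert j F)
    define z where "z = (\<Sum>k\<in>F. (x $ k) *\<^sub>R simple_root k)"
    define y where "y = (x $ j) *\<^sub>R (simple_root j :: real ^ 'n)"
    have iz: "lattice_vec z" "B z z / 2 \<in> \<int>" using insert by (auto simp: z_def)
    have xj: "x $ j \<in> \<int>" using assms by (simp add: lattice_vec_def)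
    have iy: "lattice_vec y" unfolding y_def using xj by (intro lattice_vec_scaleR) auto
    have "B (y + z) (y + z) / 2 = (x $ j) * (x $ j) + B y z + B z z / 2"
      by (simp add: form_linear B_sym[of z "simple_root j"] y_def field_simps)
    also have "\<dots> \<in> \<int>"
      using iz xj Ints_form[OF iy iz(1)] by (intro Ints_add Ints_mult) auto
    finally show ?case using insert iy iz by (simp add: z_def y_def lattice_vec_add)
  qed
  from this[of UNIV, OF finite, THEN conjunct1]
  show ?thesis by (simp only: simple_root_expansion[of x, symmetric])
qed

text \<open>
  By compactness of the unit sphere a positive definite form dominates a multiple of the
  Euclidean norm, so only finitely many lattice vectors have a given length.
\<close>

lemma finite_lattice_norm: "finite {x. lattice_vec x \<and> B x x \<le> r}"
proof -
  have cont: "continuous_on (sphere 0 1) (\<lambda>x. B x x)"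
    unfolding form_def by (intro continuous_intros)
  have "axis undefined 1 \<in> sphere (0 :: real ^ 'n) 1" by (simp add: norm_axis_1)
  then obtain u where u: "u \<in> sphere (0 :: real ^ 'n) 1" "\<And>x. x \<in> sphere 0 1 \<Longrightarrow> B u u \<le> B x x"
    using continuous_attains_inf[OF compact_sphere _ cont] by blast
  define m where "m = B u u"
  have m: "0 < m" unfolding m_def using u(1) by (intro form_pos) auto
  have ge: "m * (norm x)\<^sup>2 \<le> B x x" for x :: "real ^ 'n"
  proof (cases "x = 0")
    case False
    have "m \<le> B ((1 / norm x) *\<^sub>R x) ((1 / norm x) *\<^sub>R x)"
      unfolding m_def using False by (intro u(2)) auto
    also have "\<dots> = B x x / (norm x)\<^sup>2"
      by (simp add: form_linear power2_eq_square)
    finally show ?thesis using False by (simp add: field_simps)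
  qed (simp add: form_linear)
  have "\<bar>x $ i\<bar> \<le> sqrt (r / m)" if "B x x \<le> r" for x i
  proof -
    have "\<bar>x $ i\<bar> \<le> norm x" by (rule component_le_norm_cart)
    moreover have "(norm x)\<^sup>2 \<le> r / m" using ge[of x] that m by (simp add: field_simps)
    then have "norm x \<le> sqrt (r / m)" by (rule real_le_rsqrt)
    ultimately show ?thesis by linarith
  qed
  then show ?thesis
    by (intro finite_subset[OF _ finite_bounded_lattice[of "sqrt (r / m)"]]) auto
qed

text \<open>
  Roots are handled as lattice vectors of length two, because membership is then checked by
  computing a norm instead of exhibiting a Weyl group element.
\<close>

definition R :: "(real ^ 'n) set" where
  "R = {x. lattice_vec x \<and> B x x = 2}"

lemma R_lattice: "x \<in> R \<Longrightarrow> lattice_vec x" and R_norm: "x \<in> R \<Longrightarrow> B x x = 2"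
  by (simp_all add: R_def)

lemma finite_R: "finite R"
  unfolding R_def by (rule finite_subset[OF _ finite_lattice_norm[of 2]]) auto

lemma simple_root_R [simp]: "simple_root i \<in> R"
  by (simp add: R_def)

lemma minus_R: "x \<in> R \<Longrightarrow> - x \<in> R"
  by (simp add: R_def form_linear lattice_vec_minus)

lemma R_nonzero: "x \<in> R \<Longrightarrow> x \<noteq> 0"
  by (auto simp: R_def form_linear)

text \<open>
  Off-diagonal Cartan entries are nonpositive, so the positive and negative parts of \<open>x\<close> have
  nonpositive product; if both were nonzero, evenness would force \<open>B x x \<ge> 4\<close>.
\<close>

lemma R_sign:
  assumes "x \<in> R"
  shows "0 \<le> x \<or> x \<le> 0"
proof (rule ccontr)
  assume neg: "\<not> ?thesis"
  define p :: "real ^ 'n" where "p = (\<chi> i. max (x $ i) 0)"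
  define q :: "real ^ 'n" where "q = (\<chi> i. max (- (x $ i)) 0)"
  have x: "x = p - q" by (auto simp: vec_eq_iff p_def q_def max_def)
  have "lattice_vec p" "lattice_vec q"
    using R_lattice[OF assms] by (auto simp: lattice_vec_def p_def q_def max_def)
  then have even: "B p p / 2 \<in> \<int>" "B q q / 2 \<in> \<int>" by (simp_all add: even_norm)
  have "p \<noteq> 0" "q \<noteq> 0"
    using neg unfolding vec_eq_iff less_eq_vec_def p_def q_def max_def
    by (auto simp: not_le)
  then have "0 < B p p / 2" "0 < B q q / 2" by (simp_all add: form_pos)
  with even have ge: "1 \<le> B p p / 2" "1 \<le> B q q / 2" by (auto elim!: Ints_cases)
  have "B p q \<le> 0"
    unfolding form_def
  proof (intro sum_nonpos)
    fix i j
    show "p $ i * q $ j * cartan adj i j \<le> 0"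
    proof (cases "i = j")
      case True
      then show ?thesis by (auto simp: p_def q_def max_def)
    next
      case False
      then have "cartan adj i j \<le> 0" by (simp add: cartan_def)
      moreover have "0 \<le> p $ i * q $ j" by (simp add: p_def q_def)
      ultimately show ?thesis by (simp add: mult_nonneg_nonpos)
    qed
  qed
  moreover have "B x x = B p p + B q q - 2 * B p q"
    by (simp add: x form_linear B_sym[of q p])
  ultimately show False using ge R_norm[OF assms] by linarith
qed

text \<open>Strict Cauchy-Schwarz, combined with integrality.\<close>

lemma R_B_le:
  assumes "x \<in> R" "y \<in> R" "x \<noteq> y"
  shows "B x y \<le> 1"
proof -
  have "0 < B (x - y) (x - y)" using assms by (intro form_pos) auto
  also have "\<dots> = 4 - 2 * B x y"
    using assms R_norm[of x] R_norm[of y] by (simp add: form_linear B_sym[of y x])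
  finally have "B x y < 2" by simp
  moreover have "B x y \<in> \<int>" using assms by (simp add: Ints_form R_lattice)
  ultimately show ?thesis by (auto elim!: Ints_cases)
qed

lemma R_B_ge:
  assumes "x \<in> R" "y \<in> R" "x \<noteq> - y"
  shows "-1 \<le> B x y"
  using R_B_le[of x "- y"] assms by (auto simp: form_linear minus_R)

lemma R_pos_neq_minus: 
  assumes "x \<in> R" "y \<in> R" "0 \<le> x" "0 \<le> y"
  shows "x \<noteq> - y"
proof
  assume "x = - y"
  with assms have "x = 0" by (auto simp: less_eq_vec_def vec_eq_iff antisym)
  then show False using R_nonzero assms by blast
qed

lemma R_pos_B_ge:
  assumes "x \<in> R" "y \<in> R" "0 \<le> x" "0 \<le> y"
  shows "-1 \<le> B x y"
  using R_B_ge R_pos_neq_minus assms by blast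

lemma s_nth: "s i x $ k = x $ k - (if k = i then B (simple_root i) x else 0)"
  by (simp add: simple_reflection_def simple_root_nth)

lemma s_minus: "s i (- x) = - s i x"
  and s_add: "s i (x + y) = s i x + s i y"
  by (simp_all add: simple_reflection_def form_linear algebra_simps)

lemma B_s: "B (s i x) (s i y) = B x y"
  by (simp add: simple_reflection_def form_linear B_sym[of x "simple_root i"])

lemma s_s [simp]: "s i (s i x) = x"
  by (simp add: simple_reflection_def form_linear)

lemma s_R: "x \<in> R \<Longrightarrow> s i x \<in> R"
  by (auto simp: R_def B_s)
    (auto simp: simple_reflection_def intro!: lattice_vec_diff lattice_vec_scaleR Ints_form)

text \<open>
  A reflection changes one coordinate only, so it keeps a positive root vector positive as
  soon as some other coordinate is nonzero.
\<close>

lemma s_R_pos: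
  assumes "x \<in> R" "0 \<le> x" "x \<noteq> simple_root i"
  shows "0 \<le> s i x"
proof (rule ccontr)
  assume "\<not> 0 \<le> s i x"
  then have le: "s i x \<le> 0" using R_sign[OF s_R[OF assms(1)]] by blast
  have "x $ k = 0" if "k \<noteq> i" for k
  proof -
    have "0 \<le> x $ k" "s i x $ k \<le> 0"
      using assms(2) le by (auto simp: less_eq_vec_def)
    then show ?thesis using that by (simp add: s_nth)
  qed
  then have "x = (x $ i) *\<^sub>R simple_root i"
    by (simp add: vec_eq_iff simple_root_nth)
  then obtain c where x: "x = c *\<^sub>R simple_root i" and c: "c = x $ i"
    by metis
  have "c\<^sup>2 = 1"
    using R_norm[OF assms(1)] by (simp add: x form_linear power2_eq_square)
  moreover have "0 \<le> c" using assms(2) by (simp add: c less_eq_vec_def)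
  ultimately have "c = 1" by (simp add: power2_eq_1_iff)
  then show False using x assms(3) by simp
qed

lemma R_pos_obtain_simple:
  assumes "x \<in> R" "0 \<le> x"
  obtains i where "0 < B (simple_root i) x"
proof -
  have "\<exists>i. 0 < B (simple_root i) x"
  proof (rule ccontr)
    assume "\<nexists>i. 0 < B (simple_root i) x"
    then have "B x x \<le> 0"
      unfolding form_expand_left[of adj x x] using assms(2)
      by (intro sum_nonpos mult_nonneg_nonpos) (auto simp: less_eq_vec_def not_less)
    then show False using R_norm assms by fastforce
  qed
  with that show ?thesis by blast
qed

end

lemma summation_by_parts:
  fixes X D :: "nat \<Rightarrow> real"
  shows "(\<Sum>m=1..L. X m * (D m - D (m - 1)))
    = (\<Sum>m\<le>L. (X m - X (Suc m)) * D m) - X 0 * D 0 + X (Suc L) * D L"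
  by (induction L) (simp_all add: algebra_simps)

section \<open>Star-shaped diagrams\<close>

text \<open>
  All arms start at the centre \<open>c\<close>, their vertex number \<open>0\<close>. The inequality is the classical
  condition \<open>1/p + 1/q + 1/r > 1\<close> for a positive definite star. By the last assumption the
  centre is a branch vertex unless the diagram is a single path, which is then presented as one
  arm attached to an end vertex.
\<close>

locale star_diagram =
  fixes adj :: "'n::finite graph"
    and c :: 'n
    and arm :: "3 \<Rightarrow> nat \<Rightarrow> 'n"
    and len :: "3 \<Rightarrow> nat"
  assumes arm_0: "arm a 0 = c"
    and cover: "\<exists>a m. m \<le> len a \<and> x = arm a m"
    and arm_eq: "m \<le> len a \<Longrightarrow> n \<le> len b \<Longrightarrow> arm a m = arm b n \<longleftrightarrow> m = n \<and> (a = b \<or> m = 0)"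
    and adj_arm: "m \<le> len a \<Longrightarrow> n \<le> len b \<Longrightarrow>
      adj (arm a m) (arm b n) \<longleftrightarrow> (m = Suc n \<or> n = Suc m) \<and> (a = b \<or> m = 0 \<or> n = 0)"
    and weight: "1 < (\<Sum>a\<in>UNIV. 1 / real (len a + 1))"
    and kind: "(\<forall>a. 0 < len a) \<or> (\<forall>a. a \<noteq> 1 \<longrightarrow> len a = 0)"
begin

text \<open>
  Coefficients vanish past the end of an arm, so that its outermost vertex obeys the same
  formulas as the others.
\<close>

definition co :: "real ^ 'n \<Rightarrow> 3 \<Rightarrow> nat \<Rightarrow> real" where
  "co x a m = (if m \<le> len a then x $ arm a m else 0)"

text \<open>The orientation makes slopes positive where coefficients increase towards the centre.\<close>

definition slope :: "real ^ 'n \<Rightarrow> 3 \<Rightarrow> nat \<Rightarrow> real" where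
  "slope x a m = co x a m - co x a (Suc m)"

lemma co_0 [simp]: "co x a 0 = x $ c"
  by (simp add: co_def arm_0)

lemma co_beyond [simp]: "len a < m \<Longrightarrow> co x a m = 0"
  by (simp add: co_def)

lemma arm_cases:
  obtains "x = c" | a m where "x = arm a m" "1 \<le> m" "m \<le> len a"
  using cover[of x] arm_0 by (metis One_nat_def Suc_leI neq0_conv)

lemma neq_center: "1 \<le> m \<Longrightarrow> m \<le> len a \<Longrightarrow> arm a m \<noteq> c"
  using arm_eq[of m a 0 a] by (auto simp: arm_0)

lemma sum_vertices:
  "(\<Sum>k\<in>UNIV. f k) = f c + (\<Sum>a\<in>UNIV. \<Sum>m=1..len a. f (arm a m))" for f :: "'n \<Rightarrow> real"
proof -
  have U: "UNIV = insert c (\<Union>a\<in>UNIV. arm a ` {1..len a})"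
  proof (intro equalityI subsetI)
    fix x :: 'n
    show "x \<in> insert c (\<Union>a\<in>UNIV. arm a ` {1..len a})"
      by (cases x rule: arm_cases) fastforce+
  qed simp
  have "(\<Sum>k\<in>(\<Union>a\<in>UNIV. arm a ` {1..len a}). f k) = (\<Sum>a\<in>UNIV. \<Sum>k\<in>arm a ` {1..len a}. f k)"
    by (intro sum.UNION_disjoint) (auto simp: arm_eq)
  also have "\<dots> = (\<Sum>a\<in>UNIV. \<Sum>m=1..len a. f (arm a m))"
    by (intro sum.cong refl, subst sum.reindex) (auto simp: inj_on_def arm_eq)
  finally show ?thesis
    using neq_center by (subst U, subst sum.insert) (fastforce simp: image_iff)+
qed

lemma star_irrefl: "\<not> adj i i"
  using cover[of i] adj_arm by fastforce

lemma star_sym: "adj i j \<Longrightarrow> adj j i"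
  using cover[of i] cover[of j] adj_arm by metis

lemma neighbours_arm:
  assumes "1 \<le> m" "m \<le> len a"
  shows "neighbours adj (arm a m) = {arm a (m - 1)} \<union> (if m < len a then {arm a (Suc m)} else {})"
proof (rule set_eqI)
  fix k
  obtain b n where k: "k = arm b n" "n \<le> len b" using cover[of k] by blast
  have "arm a (m - 1) = arm b (m - 1)" if "a = b \<or> m = 1" using that arm_0 by auto
  then show "k \<in> neighbours adj (arm a m)
    \<longleftrightarrow> k \<in> {arm a (m - 1)} \<union> (if m < len a then {arm a (Suc m)} else {})"
    using assms k arm_eq[of n b "m - 1" a] arm_eq[of n b "Suc m" a]
    by (auto simp: neighbours_def adj_arm)
qed

lemma neighbours_center: "neighbours adj c = (\<lambda>a. arm a 1) ` {a. 0 < len a}"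
proof (rule set_eqI)
  fix k
  obtain b n where k: "k = arm b n" "n \<le> len b" using cover[of k] by blast
  have "adj (arm b 0) (arm b n) \<longleftrightarrow> n = 1" using adj_arm[of 0 b n b] k by auto
  then show "k \<in> neighbours adj c \<longleftrightarrow> k \<in> (\<lambda>a. arm a 1) ` {a. 0 < len a}"
    using k arm_eq[of n b 1] arm_eq[of 1 _ n b]
    by (auto simp: neighbours_def arm_0 Suc_le_eq)
qed

lemma form_simple_arm:
  assumes "1 \<le> m" "m \<le> len a"
  shows "form adj (simple_root (arm a m)) y = slope y a m - slope y a (m - 1)"
proof -
  have "(\<Sum>k\<in>neighbours adj (arm a m). y $ k) = co y a (m - 1) + co y a (Suc m)"
    unfolding neighbours_arm[OF assms] using assms by (auto simp: co_def arm_eq)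
  then show ?thesis
    using assms unfolding form_simple_neighbours[of adj, OF star_irrefl]
    by (auto simp: slope_def) (simp add: co_def)
qed

lemma form_simple_center:
  "form adj (simple_root c) y = 2 * y $ c - (\<Sum>a\<in>UNIV. co y a 1)"
proof -
  have "(\<Sum>k\<in>neighbours adj c. y $ k) = (\<Sum>a | 0 < len a. y $ arm a 1)"
    unfolding neighbours_center by (subst sum.reindex) (auto simp: inj_on_def arm_eq Suc_le_eq)
  also have "\<dots> = (\<Sum>a\<in>UNIV. co y a 1)"
    by (rule sum.mono_neutral_cong_left) (auto simp: co_def)
  finally show ?thesis by (simp add: form_simple_neighbours[of adj, OF star_irrefl])
qed

lemma vec_eq_co: "(\<And>a m. m \<le> len a \<Longrightarrow> co x a m = co y a m) \<Longrightarrow> x = y"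
  unfolding vec_eq_iff by (metis co_def cover)

lemma co_linear:
  "co (x + y) a m = co x a m + co y a m" "co (x - y) a m = co x a m - co y a m"
  "co (r *\<^sub>R x) a m = r * co x a m" "co 0 a m = 0"
  by (simp_all add: co_def)

text \<open>
  Summation by parts along each arm. In this shape the form is a sum of products of slopes,
  corrected only at the centre.
\<close>

theorem form_slopes:
  "form adj x y = (\<Sum>a\<in>UNIV. \<Sum>m\<le>len a. slope x a m * slope y a m) - x $ c * y $ c"
proof -
  have arm: "(\<Sum>m=1..len a. x $ arm a m * form adj (simple_root (arm a m)) y)
      = (\<Sum>m\<le>len a. slope x a m * slope y a m) - x $ c * slope y a 0" for a
  proof -
    have "(\<Sum>m=1..len a. x $ arm a m * form adj (simple_root (arm a m)) y)
        = (\<Sum>m=1..len a. co x a m * (slope y a m - slope y a (m - 1)))"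
      by (intro sum.cong) (auto simp: form_simple_arm co_def)
    then show ?thesis
      using summation_by_parts[of "co x a" "slope y a" "len a"] by (simp add: slope_def)
  qed
  show ?thesis
    unfolding form_expand_left[of adj x y] sum_vertices[of "\<lambda>k. x $ k * _ k"] arm
      form_simple_center
    by (simp add: sum_subtractf sum_3 slope_def algebra_simps)
qed

lemma co_sum_slope: "m \<le> Suc (len a) \<Longrightarrow> co x a m = (\<Sum>n=m..len a. slope x a n)"
proof (induction m rule: inc_induct)
  case base
  then show ?case by simp
next
  case (step n)
  have "(\<Sum>n=n..len a. slope x a n) = slope x a n + (\<Sum>n=Suc n..len a. slope x a n)"
    using step by (subst sum.atLeast_Suc_atMost) auto
  then show ?case using step by (simp add: slope_def)
qed

text \<open>
  The central coefficient is the sum of the slopes of each arm; by Cauchy-Schwarz the squares of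
  these slopes sum to at least \<open>(x $ c)\<^sup>2 / (len a + 1)\<close>, and \<open>weight\<close> beats the correction.
\<close>

lemma form_star_pos:
  assumes "x \<noteq> 0"
  shows "0 < form adj x x"
proof (rule ccontr)
  assume neg: "\<not> ?thesis"
  define S where "S a = (\<Sum>m\<le>len a. (slope x a m)\<^sup>2)" for a
  have le: "(\<Sum>a\<in>UNIV. S a) \<le> (x $ c)\<^sup>2"
    using neg by (simp add: form_slopes S_def power2_eq_square)
  have S: "(x $ c)\<^sup>2 * (1 / real (len a + 1)) \<le> S a" for a
  proof -
    have "(x $ c)\<^sup>2 = (\<Sum>m\<le>len a. slope x a m)\<^sup>2"
      using co_sum_slope[of 0 a x] by (simp add: atLeast0AtMost)
    also have "\<dots> \<le> S a * real (len a + 1)"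
      using sum_squared_le_sum_of_squares[of "slope x a" "{..len a}"] by (simp add: S_def)
    finally show ?thesis by (simp add: field_simps)
  qed
  have "(x $ c)\<^sup>2 * (\<Sum>a\<in>UNIV. 1 / real (len a + 1)) \<le> (\<Sum>a\<in>UNIV. S a)"
    unfolding sum_distrib_left by (intro sum_mono S)
  with le have "(x $ c)\<^sup>2 * (\<Sum>a\<in>UNIV. 1 / real (len a + 1)) \<le> (x $ c)\<^sup>2 * 1" by simp
  then have "x $ c = 0"
    using weight by (metis linorder_not_le mult_left_le_imp_le power2_less_eq_zero_iff)
  with le have "(\<Sum>a\<in>UNIV. S a) \<le> 0" by simp
  moreover have "0 \<le> S a" for a by (simp add: S_def sum_nonneg)
  ultimately have "S a = 0" for a
    by (metis UNIV_I finite order_antisym sum_nonneg sum_nonneg_eq_0_iff)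
  then have "slope x a m = 0" if "m \<le> len a" for a m
    using that by (auto simp: S_def sum_nonneg_eq_0_iff)
  then have "co x a m = 0" if "m \<le> len a" for a m
    using that by (simp add: co_sum_slope)
  then have "x = 0" by (intro vec_eq_co) (simp add: co_linear)
  with assms show False ..
qed

lemma star_connected:
  assumes "i \<in> A" and closed: "\<And>j k. j \<in> A \<Longrightarrow> adj j k \<Longrightarrow> k \<in> A"
  shows "A = UNIV"
proof -
  have down: "c \<in> A" if "m \<le> len a" "arm a m \<in> A" for a m
    using that
  proof (induction m)
    case (Suc m)
    moreover have "adj (arm a (Suc m)) (arm a m)" using Suc by (simp add: adj_arm)
    ultimately show ?case using closed by simp
  qed (simp add: arm_0)
  then have c: "c \<in> A" using cover[of i] assms(1) by blast
  have "arm a m \<in> A" if "m \<le> len a" for a m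
    using that
  proof (induction m)
    case (Suc m)
    moreover have "adj (arm a m) (arm a (Suc m))" using Suc by (simp add: adj_arm)
    ultimately show ?case using closed by simp
  qed (simp add: arm_0 c)
  then show ?thesis using cover by (metis UNIV_eq_I)
qed

sublocale positive_diagram adj
  by unfold_locales (fact star_sym star_irrefl star_connected form_star_pos)+

section \<open>The canonical basis of a star-shaped diagram\<close>

text \<open>
  Read from the centre, a path without repetition cannot turn back, so it follows the arm on
  which it starts.
\<close>

lemma simple_path_arm:
  assumes "simple_path adj (arm a m) c p" "1 \<le> m" "m \<le> len a"
  shows "set p = arm a ` {..m}"
proof -
  define q where "q = rev p"
  have p: "p \<noteq> []" "hd p = arm a m" "last p = c" "distinct p" "successively adj p"
    using assms(1) by (auto simp: simple_path_def)
  have q: "q \<noteq> []" "distinct q" using p by (auto simp: q_def)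
  have q0: "q ! 0 = c"
    using p hd_conv_nth[OF q(1)] by (simp add: q_def hd_rev)
  have q_last: "q ! (length q - 1) = arm a m"
    using p last_conv_nth[OF q(1)] by (simp add: q_def last_rev)
  have "successively adj q"
    unfolding q_def using p(5) star_sym by (auto simp: successively_rev intro: successively_mono)
  then have step: "adj (q ! r) (q ! Suc r)" if "Suc r < length q" for r
    using that by (simp add: successively_conv_nth)
  have "c \<noteq> arm a m" using neq_center assms by metis
  then have "length q \<noteq> 1" using q0 q_last by auto
  then have len2: "1 < length q" using q(1) by (cases q) auto
  then have "q ! 1 \<in> neighbours adj c" using step[of 0] q0 by (simp add: neighbours_def)
  then obtain b where b: "q ! 1 = arm b 1" "0 < len b" unfolding neighbours_center by blast
  have on_arm: "r < length q \<longrightarrow> r \<le> len b \<and> q ! r = arm b r" for r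
  proof (induction r rule: less_induct)
    case (less r)
    consider "r = 0" | "r = 1" | n where "r = Suc (Suc n)"
      by (metis One_nat_def old.nat.exhaust)
    then show ?case
    proof cases
      case 3
      show ?thesis
      proof
        assume r: "r < length q"
        have n: "q ! n = arm b n" "q ! Suc n = arm b (Suc n)" "Suc n \<le> len b"
          using less r 3 by auto
        have "q ! r \<in> neighbours adj (arm b (Suc n))"
          using step[of "Suc n"] n r 3 by (simp add: neighbours_def)
        moreover have "q ! r \<noteq> q ! n" using q(2) r 3 by (simp add: nth_eq_iff_index_eq)
        ultimately show "r \<le> len b \<and> q ! r = arm b r"
          using n 3 by (auto simp: neighbours_arm split: if_splits)
      qed
    qed (use b q0 arm_0 in auto)
  qed
  have "length q - 1 \<le> len b" "arm a m = arm b (length q - 1)"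
    using on_arm[of "length q - 1"] q_last len2 by auto
  then have m: "length q = Suc m" "a = b"
    using arm_eq[of m a "length q - 1" b] assms len2 by auto
  have "set q = (\<lambda>r. q ! r) ` {..<length q}" by (auto simp: set_conv_nth)
  also have "\<dots> = arm a ` {..m}"
    using on_arm m by (intro image_cong) auto
  finally show ?thesis by (simp add: q_def)
qed

lemma simple_path_arm_exists:
  assumes "m \<le> len a"
  shows "simple_path adj (arm a m) c (rev (map (arm a) [0..<Suc m]))"
  unfolding simple_path_def
proof (intro conjI)
  show "hd (rev (map (arm a) [0..<Suc m])) = arm a m" by simp
  show "last (rev (map (arm a) [0..<Suc m])) = c"
    by (simp add: last_rev hd_map arm_0 del: upt_Suc)
  show "distinct (rev (map (arm a) [0..<Suc m]))"
    unfolding distinct_rev distinct_map using assms by (auto simp: inj_on_def arm_eq)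
  show "successively adj (rev (map (arm a) [0..<Suc m]))"
    unfolding successively_rev successively_map
    unfolding successively_conv_nth using assms by (auto simp: adj_arm simp del: upt_Suc)
qed simp

lemma branch_vertex_iff: "branch_vertex adj x \<longleftrightarrow> x = c \<and> (\<forall>a. 0 < len a)"
proof (cases x rule: arm_cases)
  case 1
  have "card (neighbours adj c) = card {a. 0 < len a}"
    unfolding neighbours_center by (intro card_image) (auto simp: inj_on_def arm_eq Suc_le_eq)
  moreover have "3 \<le> card {a :: 3. 0 < len a} \<longleftrightarrow> {a. 0 < len a} = UNIV"
  proof
    assume "3 \<le> card {a :: 3. 0 < len a}"
    then show "{a. 0 < len a} = UNIV" by (intro card_seteq) auto
  qed simp
  ultimately show ?thesis using 1 by (auto simp: branch_vertex_def)
next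
  case (2 a m)
  have "card (neighbours adj x) \<le> card {arm a (m - 1), arm a (Suc m)}"
    unfolding 2(1) neighbours_arm[OF 2(2,3)] by (intro card_mono) auto
  also have "\<dots> \<le> 2" by (simp add: card_insert_if)
  finally show ?thesis using 2 neq_center by (auto simp: branch_vertex_def)
qed

text \<open>
  The highest root of the subdiagram of type \<open>D\<close> spanned by the centre, its neighbours and
  the first \<open>m\<close> vertices of arm \<open>a\<close>.
\<close>

definition theta :: "3 \<Rightarrow> nat \<Rightarrow> real ^ 'n" where
  "theta a m = (\<chi> k. if k = arm a m then 1 else if k \<in> arm a ` {..<m} then 2
     else if \<exists>b. b \<noteq> a \<and> k = arm b 1 then 1 else 0)"

context
  assumes branched: "\<And>a. 0 < len a"
begin

lemma len_ge: "Suc 0 \<le> len a" and len_nonzero: "len a \<noteq> 0"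
  using branched[of a] by simp_all

lemma co_theta:
  assumes "1 \<le> m" "m \<le> len a" "n \<le> len b"
  shows "co (theta a m) b n =
    (if b = a \<or> n = 0 then if n = m then 1 else if n < m then 2 else 0 else if n = 1 then 1 else 0)"
proof -
  have 1: "arm b n = arm a m \<longleftrightarrow> n = m \<and> b = a" using assms by (auto simp: arm_eq)
  have 2: "arm b n \<in> arm a ` {..<m} \<longleftrightarrow> n < m \<and> (b = a \<or> n = 0)"
    using assms by (auto simp: arm_eq image_iff)
  have 3: "(\<exists>b'. b' \<noteq> a \<and> arm b n = arm b' 1) \<longleftrightarrow> n = 1 \<and> b \<noteq> a"
  proof -
    have "arm b n = arm b' 1 \<longleftrightarrow> n = 1 \<and> b = b'" for b'
      using arm_eq[of n b 1 b'] assms(3) len_ge by auto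
    then show ?thesis by auto
  qed
  show ?thesis
    using assms unfolding co_def theta_def by (simp only: vec_lambda_beta 1 2 3) auto
qed

lemma highest_root_D_theta:
  assumes m: "1 \<le> m" "m \<le> len a"
  shows "highest_root_D adj (arm a ` {..m} \<union> neighbours adj c) = theta a m"
proof (rule vec_eq_co)
  fix b n assume n: "n \<le> len b"
  define S where "S = arm a ` {..m} \<union> neighbours adj c"
  have S: "arm b n \<in> S \<longleftrightarrow> b = a \<and> n \<le> m \<or> n = 0 \<or> n = 1" if "n \<le> len b" for b n
    using that m len_ge unfolding S_def neighbours_center by (auto simp: arm_eq image_iff len_nonzero)
  have card: "card (neighbours adj (arm b n) \<inter> S) = 1 \<longleftrightarrow> \<not> (b = a \<and> n < m) \<and> n \<noteq> 0"
    if "arm b n \<in> S"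
  proof (cases "n = 0")
    case True
    then have "neighbours adj (arm b n) \<inter> S = range (\<lambda>a. arm a 1)"
      using branched by (auto simp: arm_0 S_def neighbours_center)
    moreover have "card (range (\<lambda>a. arm a 1)) = card (UNIV :: 3 set)"
      using len_ge by (intro card_image) (auto simp: inj_on_def arm_eq)
    ultimately show ?thesis using True by simp
  next
    case False
    have prev: "arm b (n - 1) \<in> S"
      using S[of "n - 1" b] S[of n b] n that by auto
    show ?thesis
    proof (cases "b = a \<and> n < m")
      case True
      then have "neighbours adj (arm b n) \<inter> S = {arm b (n - 1), arm b (Suc n)}"
        using False prev S[of "Suc n" b] m n by (auto simp: neighbours_arm)
      moreover have "arm b (n - 1) \<noteq> arm b (Suc n)" using True m by (subst arm_eq) auto
      ultimately show ?thesis using True False by simp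
    next
      case other: False
      have "neighbours adj (arm b n) \<inter> S = {arm b (n - 1)}"
        using False prev other S[of "Suc n" b] m n by (auto simp: neighbours_arm)
      then show ?thesis using other False by simp
    qed
  qed
  have hr: "highest_root_D adj S $ k = (if k \<in> S then if card (neighbours adj k \<inter> S) = 1 then 1 else 2 else 0)"
    for k
    by (simp add: highest_root_D_def simple_root_nth if_distrib[where f="\<lambda>t. _ * t"] cong: if_cong)
  have "co (highest_root_D adj S) b n =
      (if arm b n \<in> S then if \<not> (b = a \<and> n < m) \<and> n \<noteq> 0 then 1 else 2 else 0)"
    using n card by (simp add: co_def hr)
  also have "\<dots> = co (theta a m) b n"
    unfolding co_theta[OF m n] S[OF n] using m by auto
  finally show "co (highest_root_D adj (arm a ` {..m} \<union> neighbours adj c)) b n = co (theta a m) b n"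
    unfolding S_def .
qed

lemma elementary_theta:
  assumes m: "1 \<le> m" "m \<le> len a"
  shows "elementary adj (arm a m) (theta a m)"
proof -
  have "branch_vertex adj c" using branched by (simp add: branch_vertex_iff)
  moreover have "arm a m \<noteq> c" by (rule neq_center[OF m])
  ultimately show ?thesis
    using elementary.branch[OF _ _ simple_path_arm_exists[OF m(2)]]
      simple_path_arm[OF simple_path_arm_exists[OF m(2)] m] highest_root_D_theta[OF m] by metis
qed

lemma slope_theta:
  assumes m: "1 \<le> m" "m \<le> len a"
  shows "slope (theta a m) a m = 1" "slope (theta a m) a (m - 1) = 1"
proof -
  show "slope (theta a m) a m = 1"
    using m by (cases "m < len a") (auto simp: slope_def co_theta)
  show "slope (theta a m) a (m - 1) = 1"
    using m by (auto simp: slope_def co_theta)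
qed

end

lemma elementary_star_cases:
  assumes "elementary adj i y"
  obtains (simple) j where "j \<noteq> i" "\<not> adj i j" "y = simple_root j"
  | (path) h j where "adj h i" "adj i j" "h \<noteq> j" "y = simple_root h + simple_root i + simple_root j"
  | (branch) a m where "\<And>b. 0 < len b" "i = arm a m" "1 \<le> m" "m \<le> len a" "y = theta a m"
  using assms
proof cases
  case (branch x p)
  then have x: "x = c" "\<And>b. 0 < len b" by (auto simp: branch_vertex_iff)
  obtain a m where "i = arm a m" "1 \<le> m" "m \<le> len a"
    using branch x(1) by (cases i rule: arm_cases) auto
  then show ?thesis
    using that(3) x branch simple_path_arm highest_root_D_theta by metis
qed (use that in auto)

lemma elementary_orthogonal:
  assumes "elementary adj i y"
  shows "B (simple_root i) y = 0"
  using assms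
proof (cases rule: elementary_star_cases)
  case (branch a m)
  then show ?thesis using slope_theta[OF branch(1,3,4)] by (simp add: form_simple_arm)
next
  case (path h j)
  then have "h \<noteq> i" "j \<noteq> i" using star_irrefl by auto
  then show ?thesis using path star_sym by (simp add: form_linear form_simple_simple cartan_def)
qed (auto simp: form_simple_simple cartan_def)

end

section \<open>Orthogonal complements of simple roots\<close>

inductive_set elementary_cone :: "'n::finite graph \<Rightarrow> 'n \<Rightarrow> (real ^ 'n) set"
  for adj :: "'n graph" and i :: 'n where
  zero: "0 \<in> elementary_cone adj i"
| add: "elementary adj i e \<Longrightarrow> y \<in> elementary_cone adj i \<Longrightarrow> e + y \<in> elementary_cone adj i"

lemma elementary_cone_add:
  "x \<in> elementary_cone adj i \<Longrightarrow> y \<in> elementary_cone adj i \<Longrightarrow> x + y \<in> elementary_cone adj i"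
  by (induction rule: elementary_cone.induct) (auto simp: add.assoc intro: elementary_cone.add)

lemma elementary_cone_scaleR:
  assumes "elementary adj i e" "r \<in> \<int>" "0 \<le> r"
  shows "r *\<^sub>R e \<in> elementary_cone adj i"
proof -
  have "real n *\<^sub>R e \<in> elementary_cone adj i" for n
    by (induction n) (auto simp: scaleR_add_left intro: elementary_cone.intros assms(1))
  moreover obtain n where "r = real n"
    using assms(2,3) by (metis Ints_cases of_int_0_le_iff of_int_of_nat_eq zero_le_imp_eq_int)
  ultimately show ?thesis by simp
qed

lemma elementary_cone_sum:
  "(\<And>k. k \<in> A \<Longrightarrow> f k \<in> elementary_cone adj i) \<Longrightarrow> (\<Sum>k\<in>A. f k) \<in> elementary_cone adj i"
  by (induction A rule: infinite_finite_induct)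
    (auto intro: elementary_cone.zero elementary_cone_add)

lemma elementary_cone_nonadjacent:
  assumes "lattice_vec y" "0 \<le> y" "y $ i = 0" "\<And>j. adj i j \<Longrightarrow> y $ j = 0"
  shows "y \<in> elementary_cone adj i"
proof -
  have "(y $ k) *\<^sub>R simple_root k \<in> elementary_cone adj i" for k
  proof (cases "k = i \<or> adj i k")
    case True
    then have "y $ k = 0" using assms by auto
    then show ?thesis by (simp add: elementary_cone.zero)
  next
    case False
    then have "elementary adj i (simple_root k)" by (intro elementary.simple) auto
    then show ?thesis
      using assms by (intro elementary_cone_scaleR) (auto simp: lattice_vec_def less_eq_vec_def)
  qed
  then show ?thesis by (subst simple_root_expansion) (rule elementary_cone_sum)
qed

context star_diagram
begin

text \<open>The sum of a run of consecutive simple roots of an arm is a root of type \<open>A\<close>.\<close>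

definition segment :: "3 \<Rightarrow> nat \<Rightarrow> nat \<Rightarrow> real ^ 'n" where
  "segment a m n = (\<Sum>r=m..n. simple_root (arm a r))"

lemma B_segment:
  assumes "1 \<le> m" "m \<le> n" "n \<le> len a"
  shows "B (segment a m n) x = slope x a n - slope x a (m - 1)"
proof -
  have "B (segment a m n) x = (\<Sum>r=m..n. slope x a r - slope x a (r - 1))"
    unfolding segment_def form_sum_left
    using assms by (intro sum.cong refl form_simple_arm) auto
  also have "\<dots> = slope x a n - slope x a (m - 1)"
    using assms(2,1) by (induction n rule: dec_induct) (auto simp: not_less_eq_eq)
  finally show ?thesis .
qed

lemma co_segment:
  assumes "1 \<le> m" "n \<le> len a"
  shows "co (segment a m n) b r = (if b = a \<and> m \<le> r \<and> r \<le> n then 1 else 0)"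
proof (cases "r \<le> len b")
  case True
  have "co (segment a m n) b r = (\<Sum>q=m..n. if q = r \<and> b = a then 1 else 0)"
    unfolding co_def segment_def using True assms
    by (auto simp: simple_root_nth arm_eq intro!: sum.cong)
  then show ?thesis using assms by auto
qed (use assms in auto)

lemma segment_R:
  assumes "1 \<le> m" "m \<le> n" "n \<le> len a"
  shows "segment a m n \<in> R" "0 \<le> segment a m n"
proof -
  have "lattice_vec (segment a m n)" "0 \<le> segment a m n"
    by (auto simp: segment_def lattice_vec_def less_eq_vec_def simple_root_nth sum_nonneg)
  moreover have "B (segment a m n) (segment a m n) = 2"
    unfolding B_segment[OF assms] using assms by (auto simp: slope_def co_segment)
  ultimately show "segment a m n \<in> R" "0 \<le> segment a m n" by (auto simp: R_def)
qed

text \<open>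
  The difference of two slopes of a root along an arm is its product with a segment, so it is
  at least \<open>-1\<close>, and at most \<open>1\<close> unless the root is that segment. Orthogonality to a simple
  root next to the segment excludes the latter.
\<close>

lemma slope_ge:
  assumes "\<beta> \<in> R" "0 \<le> \<beta>" "1 \<le> m" "m \<le> n" "n \<le> len a"
  shows "slope \<beta> a (m - 1) - 1 \<le> slope \<beta> a n"
  using R_pos_B_ge[OF segment_R(1)[OF assms(3-5)] assms(1) segment_R(2)[OF assms(3-5)] assms(2)]
  by (simp add: B_segment[OF assms(3-5)])

lemma slope_le_outward:
  assumes "\<beta> \<in> R" "B (simple_root (arm a l)) \<beta> = 0" "l < n" "n \<le> len a"
  shows "slope \<beta> a n \<le> slope \<beta> a l + 1"
proof -
  have seg: "1 \<le> Suc l" "Suc l \<le> n" "n \<le> len a" using assms by auto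
  have "B (simple_root (arm a l)) (segment a (Suc l) n) = -1"
  proof (cases l)
    case 0
    have "(\<Sum>b\<in>UNIV. co (segment a (Suc l) n) b 1) = (\<Sum>b\<in>UNIV. if b = a then 1 else 0)"
      using seg 0 by (intro sum.cong) (auto simp: co_segment)
    then have "(\<Sum>b\<in>UNIV. co (segment a (Suc l) n) b 1) = 1" by simp
    moreover have "segment a (Suc l) n $ c = 0"
      using co_segment[OF seg(1,3), of a 0] by simp
    ultimately show ?thesis using 0 by (simp add: arm_0 form_simple_center)
  next
    case (Suc k)
    then show ?thesis using seg by (simp add: form_simple_arm slope_def co_segment)
  qed
  then have "segment a (Suc l) n \<noteq> \<beta>" using assms(2) by auto
  then have "B (segment a (Suc l) n) \<beta> \<le> 1"
    using R_B_le segment_R(1)[OF seg] assms(1) by blast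
  then show ?thesis by (simp add: B_segment[OF seg])
qed

lemma slope_ge_inward:
  assumes "\<beta> \<in> R" "B (simple_root (arm a l)) \<beta> = 0" "n + 1 < l" "l \<le> len a"
  shows "slope \<beta> a (l - 1) - 1 \<le> slope \<beta> a n"
proof -
  have seg: "1 \<le> Suc n" "Suc n \<le> l - 1" "l - 1 \<le> len a" using assms by auto
  have "B (simple_root (arm a l)) (segment a (Suc n) (l - 1)) = -1"
    using assms seg by (auto simp: form_simple_arm slope_def co_segment)
  then have "segment a (Suc n) (l - 1) \<noteq> \<beta>" using assms(2) by auto
  then have "B (segment a (Suc n) (l - 1)) \<beta> \<le> 1"
    using R_B_le segment_R(1)[OF seg] assms(1) by blast
  then show ?thesis unfolding B_segment[OF seg] by simp
qed

lemma Ints_co: "lattice_vec x \<Longrightarrow> co x a m \<in> \<int>"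
  by (simp add: co_def lattice_vec_def)

lemma Ints_slope: "lattice_vec x \<Longrightarrow> slope x a m \<in> \<int>"
  by (simp add: slope_def Ints_co)

lemma co_nonneg: "0 \<le> x \<Longrightarrow> 0 \<le> co x a m"
  by (simp add: co_def less_eq_vec_def)

text \<open>
  If the slope were negative at a vertex orthogonal to \<open>\<beta>\<close>, all slopes further out would be at
  most zero, and the coefficient at that vertex, the sum of all these slopes, would be negative.
\<close>

lemma slope_nonneg:
  assumes "\<beta> \<in> R" "0 \<le> \<beta>" "B (simple_root (arm a l)) \<beta> = 0" "l \<le> len a"
  shows "0 \<le> slope \<beta> a l"
proof (rule ccontr)
  assume "\<not> 0 \<le> slope \<beta> a l"
  then have t: "slope \<beta> a l \<le> -1"
    using Ints_slope[OF R_lattice[OF assms(1)], of a l] by (auto elim!: Ints_cases)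
  have "slope \<beta> a n \<le> 0" if "l < n" "n \<le> len a" for n
    using slope_le_outward[OF assms(1,3) that] t by simp
  then have "(\<Sum>n=Suc l..len a. slope \<beta> a n) \<le> 0" by (intro sum_nonpos) auto
  moreover have "co \<beta> a (Suc l) = (\<Sum>n=Suc l..len a. slope \<beta> a n)"
    using assms(4) by (intro co_sum_slope) auto
  moreover have "co \<beta> a l = slope \<beta> a l + co \<beta> a (Suc l)" by (simp add: slope_def)
  moreover have "0 \<le> co \<beta> a l" by (rule co_nonneg[OF assms(2)])
  ultimately show False using t by linarith
qed

text \<open>
  Towards the centre no slope is smaller than \<open>t - 1\<close>, where \<open>t\<close> is the slope at the vertex; so
  for positive \<open>t\<close> the coefficients do not decrease.
\<close>

lemma co_ge_inward:
  assumes "\<beta> \<in> R" "0 \<le> \<beta>" "B (simple_root (arm a l)) \<beta> = 0" "1 \<le> l" "l \<le> len a"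
    and t: "1 \<le> slope \<beta> a l" and "n < l"
  shows "2 * slope \<beta> a l \<le> co \<beta> a n"
proof -
  have eq: "slope \<beta> a (l - 1) = slope \<beta> a l"
    using assms by (simp add: form_simple_arm)
  have mono: "co \<beta> a (l - 1) \<le> co \<beta> a n"
    using \<open>n < l\<close>
  proof (induction "l - 1 - n" arbitrary: n)
    case 0
    then have "n = l - 1" by simp
    then show ?case by simp
  next
    case (Suc k)
    then have "n + 1 < l" by linarith
    then have "0 \<le> slope \<beta> a n" using slope_ge_inward[OF assms(1,3) _ assms(5), of n] eq t by simp
    moreover have "co \<beta> a (l - 1) \<le> co \<beta> a (Suc n)" using Suc by (intro Suc.hyps) auto
    ultimately show ?case by (simp add: slope_def)
  qed
  have "co \<beta> a (l - 1) = slope \<beta> a (l - 1) + (slope \<beta> a l + co \<beta> a (Suc l))"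
    using assms(4) by (simp add: slope_def)
  moreover have "0 \<le> co \<beta> a (Suc l)" by (rule co_nonneg[OF assms(2)])
  ultimately show ?thesis using mono eq by linarith
qed

text \<open>
  If the first coefficient of another arm were smaller than \<open>t\<close>, the drop from the centre would
  be at least \<open>t + 1\<close>, so each slope on that arm would be at least \<open>t\<close>, and their sum too.
\<close>

lemma co_ge_other_arm:
  assumes "\<beta> \<in> R" "0 \<le> \<beta>" "B (simple_root (arm a l)) \<beta> = 0" "1 \<le> l" "l \<le> len a"
    and t: "1 \<le> slope \<beta> a l" and "0 < len b"
  shows "slope \<beta> a l \<le> co \<beta> b 1"
proof (rule ccontr)
  let ?t = "slope \<beta> a l"
  assume "\<not> ?t \<le> co \<beta> b 1"
  moreover have "2 * ?t \<le> \<beta> $ c"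
    using co_ge_inward[OF assms(1-6), of 0] assms(4) by simp
  moreover have "?t \<in> \<int>" "co \<beta> b 1 \<in> \<int>"
    using R_lattice[OF assms(1)] by (simp_all add: Ints_slope Ints_co)
  ultimately have "?t + 1 \<le> slope \<beta> b 0"
    by (auto simp: slope_def elim!: Ints_cases)
  then have ge: "?t \<le> slope \<beta> b n" if "1 \<le> n" "n \<le> len b" for n
    using slope_ge[OF assms(1,2) order_refl that] by simp
  have "?t \<le> slope \<beta> b 1" using \<open>0 < len b\<close> by (intro ge) auto
  also have "\<dots> \<le> (\<Sum>n=1..len b. slope \<beta> b n)"
  proof (rule member_le_sum)
    show "1 \<in> {1..len b}" using \<open>0 < len b\<close> by simp
    show "0 \<le> slope \<beta> b n" if "n \<in> {1..len b} - {1}" for n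
      using ge[of n] that t by auto
  qed simp
  also have "\<dots> = co \<beta> b 1" by (simp add: co_sum_slope)
  finally show False using \<open>\<not> ?t \<le> co \<beta> b 1\<close> by simp
qed

text \<open>
  Without a branch vertex the squares of the slopes and of the central coefficient sum to two,
  which leaves no room for two equal nonzero slopes.
\<close>

lemma slope_unbranched:
  assumes "\<beta> \<in> R" "0 \<le> \<beta>" "B (simple_root (arm a l)) \<beta> = 0" "1 \<le> l" "l \<le> len a"
    and unbranched: "\<And>b. b \<noteq> 1 \<Longrightarrow> len b = 0"
  shows "slope \<beta> a l = 0"
proof (rule ccontr)
  assume "slope \<beta> a l \<noteq> 0"
  moreover have "slope \<beta> a l \<in> \<int>" using R_lattice[OF assms(1)] by (simp add: Ints_slope)
  ultimately have t: "1 \<le> slope \<beta> a l"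
    using slope_nonneg[OF assms(1-3,5)] by (auto elim!: Ints_cases)
  have a: "a = 1" using unbranched[of a] assms(4,5) by fastforce
  have eq: "slope \<beta> a (l - 1) = slope \<beta> a l"
    using assms by (simp add: form_simple_arm)
  have c: "2 \<le> \<beta> $ c"
    using co_ge_inward[OF assms(1-5) t, of 0] assms(4) t by simp
  have "(3 :: 3) \<noteq> 1" "(2 :: 3) \<noteq> 1" by auto
  then have len: "len 3 = 0" "len 2 = 0" using unbranched by blast+
  have "2 = (\<Sum>m\<le>len 1. (slope \<beta> 1 m)\<^sup>2) + (\<beta> $ c)\<^sup>2"
    using R_norm[OF assms(1)] unfolding form_slopes
    by (simp add: sum_3 len slope_def power2_eq_square)
  moreover have "0 \<le> (\<Sum>m\<le>len 1. (slope \<beta> 1 m)\<^sup>2)" by (simp add: sum_nonneg)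
  moreover have "2\<^sup>2 \<le> (\<beta> $ c)\<^sup>2" using c by (intro power_mono) auto
  ultimately show False by simp
qed

text \<open>
  At a branch vertex only paths through two of the three arms and nonadjacent simple roots are
  available; the slopes at the centre are the multiplicities of the paths. If the centre is the
  end of a path, orthogonality makes the coefficients at it and at its neighbour vanish.
\<close>

lemma orthogonal_root_in_cone_center:
  assumes \<beta>: "\<beta> \<in> R" "0 \<le> \<beta>" "B (simple_root c) \<beta> = 0"
  shows "\<beta> \<in> elementary_cone adj c"
proof -
  have bal: "2 * \<beta> $ c = (\<Sum>a\<in>UNIV. co \<beta> a 1)"
    using \<beta>(3) by (simp add: form_simple_center)
  have t: "0 \<le> slope \<beta> a 0" for a
    using slope_nonneg[OF \<beta>(1,2), of a 0] \<beta>(3) by (simp add: arm_0)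
  from kind show ?thesis
  proof
    assume branched: "\<forall>a. 0 < len a"
    have neq: "(2 :: 3) \<noteq> 1" "(3 :: 3) \<noteq> 1" "(3 :: 3) \<noteq> 2" by auto
    have adj_c: "adj c (arm a 1)" "adj (arm a 1) c" for a
      using adj_arm[of 0 a 1 a] adj_arm[of 1 a 0 a] branched arm_0 by (auto simp: Suc_le_eq)
    define P where "P a b = simple_root (arm a 1) + simple_root c + simple_root (arm b 1)" for a b
    have el: "elementary adj c (P a b)" if "a \<noteq> b" for a b
      unfolding P_def using that branched adj_c
      by (intro elementary.path) (auto simp: arm_eq Suc_le_eq)
    \<comment> \<open>The path missing arm \<open>a\<close> occurs as often as the coefficient drops along arm \<open>a\<close>.\<close>
    define z where "z = slope \<beta> 1 0 *\<^sub>R P 2 3 + slope \<beta> 2 0 *\<^sub>R P 1 3 + slope \<beta> 3 0 *\<^sub>R P 1 2"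
    have z: "z \<in> elementary_cone adj c"
      unfolding z_def using t R_lattice[OF \<beta>(1)] neq
      by (intro elementary_cone_add elementary_cone_scaleR el) (auto simp: Ints_slope)
    have co_P: "co (P a b) d n = (if n = 0 then 1 else if n = 1 \<and> (d = a \<or> d = b) then 1 else 0)"
      if "n \<le> len d" "a \<noteq> b" for a b d n
    proof (cases "n = 0")
      case True
      then show ?thesis
        using branched neq_center[of 1 a] neq_center[of 1 b]
        by (auto simp: P_def simple_root_nth Suc_le_eq)
    next
      case False
      then show ?thesis using that branched neq_center[of n d]
        by (auto simp: co_def P_def simple_root_nth arm_eq Suc_le_eq)
    qed
    have co_z: "co z d n = (if n = 0 then \<beta> $ c else if n = 1 then co \<beta> d 1 else 0)"
      if n: "n \<le> len d" for d n
    proof -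
      have d: "d = 1 \<or> d = 2 \<or> d = 3" using exhaust_3 by blast
      have "co z d n = slope \<beta> 1 0 * co (P 2 3) d n + slope \<beta> 2 0 * co (P 1 3) d n
          + slope \<beta> 3 0 * co (P 1 2) d n"
        by (simp add: z_def co_linear)
      then show ?thesis
        using d neq neq[symmetric] bal n by (auto simp: co_P slope_def sum_3)
    qed
    have "co (\<beta> - z) d n = (if n \<le> 1 then 0 else co \<beta> d n)" if "n \<le> len d" for d n
      using that by (auto simp: co_linear co_z le_Suc_eq)
    then have y: "(\<beta> - z) $ arm d n = (if n \<le> 1 then 0 else \<beta> $ arm d n)" if "n \<le> len d" for d n
      using that by (simp add: co_def split: if_splits)
    have "\<beta> - z \<in> elementary_cone adj c"
    proof (rule elementary_cone_nonadjacent)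
      show "0 \<le> \<beta> - z" unfolding less_eq_vec_def
        using y \<beta>(2) cover by (metis less_eq_vec_def order_refl zero_index)
      have "(\<beta> - z) $ k \<in> \<int>" for k
      proof -
        obtain d n where k: "k = arm d n" "n \<le> len d" using cover by blast
        show ?thesis
          unfolding k(1) y[OF k(2)] using R_lattice[OF \<beta>(1)] by (simp add: lattice_vec_def)
      qed
      then show "lattice_vec (\<beta> - z)" by (simp add: lattice_vec_def)
      show "(\<beta> - z) $ c = 0" using y[of 0 1] by (simp add: arm_0)
      fix j assume "adj c j"
      then have "j \<in> neighbours adj c" by (simp add: neighbours_def)
      then obtain a where "j = arm a 1" "0 < len a" unfolding neighbours_center by blast
      then show "(\<beta> - z) $ j = 0" using y[of 1 a] by simp
    qed
    from elementary_cone_add[OF z this] show ?thesis by simp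
  next
    assume unbranched: "\<forall>a. a \<noteq> 1 \<longrightarrow> len a = 0"
    have neq: "(2 :: 3) \<noteq> 1" "(3 :: 3) \<noteq> 1" by auto
    then have "2 * \<beta> $ c = co \<beta> 1 1"
      using bal unbranched by (simp add: sum_3)
    moreover have "co \<beta> 1 1 \<le> \<beta> $ c" using t[of 1] by (simp add: slope_def)
    moreover have "0 \<le> \<beta> $ c" using \<beta>(2) by (simp add: less_eq_vec_def)
    ultimately have 0: "\<beta> $ c = 0" "co \<beta> 1 1 = 0" by linarith+
    show ?thesis
    proof (rule elementary_cone_nonadjacent[OF R_lattice[OF \<beta>(1)] \<beta>(2) 0(1)])
      fix j assume "adj c j"
      then have "j \<in> neighbours adj c" by (simp add: neighbours_def)
      then obtain a where a: "j = arm a 1" "0 < len a" unfolding neighbours_center by blast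
      then have "a = 1" using unbranched by (metis less_irrefl)
      then show "\<beta> $ j = 0" using 0(2) a by (simp add: co_def Suc_le_eq)
    qed
  qed
qed

text \<open>
  On an arm, orthogonality makes the coefficients at the inner neighbour, the vertex and the outer
  neighbour equal to \<open>h + 2 t\<close>, \<open>h + t\<close> and \<open>h\<close>. This is \<open>t\<close> times \<open>theta\<close> plus \<open>h\<close> times the path,
  and what remains lives on nonadjacent vertices.
\<close>

lemma orthogonal_root_in_cone_arm:
  assumes \<beta>: "\<beta> \<in> R" "0 \<le> \<beta>" "B (simple_root (arm a m)) \<beta> = 0" and m: "1 \<le> m" "m \<le> len a"
  shows "\<beta> \<in> elementary_cone adj (arm a m)"
proof -
  define t where "t = slope \<beta> a m"
  define h where "h = co \<beta> a (Suc m)"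
  have eq: "slope \<beta> a (m - 1) = t"
    using \<beta>(3) by (simp add: form_simple_arm[OF m] t_def)
  have co_m: "co \<beta> a m = t + h" "co \<beta> a (m - 1) = 2 * t + h"
    using eq m by (auto simp: t_def h_def slope_def)
  have t0: "0 \<le> t" unfolding t_def using \<beta> m by (intro slope_nonneg)
  have tZ: "t \<in> \<int>" unfolding t_def using R_lattice[OF \<beta>(1)] by (simp add: Ints_slope)
  have branched: "0 < len b" if "t \<noteq> 0" for b
    using kind slope_unbranched[OF \<beta> m] that unfolding t_def by blast
  define P where "P = simple_root (arm a (m - 1)) + simple_root (arm a m) + simple_root (arm a (Suc m))"
  have hP: "h *\<^sub>R P \<in> elementary_cone adj (arm a m)"
  proof (cases "m < len a")
    case True
    then have "elementary adj (arm a m) P"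
      unfolding P_def using m by (intro elementary.path) (auto simp: adj_arm arm_eq)
    then show ?thesis
      unfolding h_def using R_lattice[OF \<beta>(1)] \<beta>(2)
      by (intro elementary_cone_scaleR) (auto simp: Ints_co co_nonneg)
  next
    case False
    then show ?thesis by (simp add: h_def elementary_cone.zero)
  qed
  have tT: "t *\<^sub>R theta a m \<in> elementary_cone adj (arm a m)"
  proof (cases "t = 0")
    case False
    then show ?thesis
      using branched elementary_theta[OF _ m] t0 tZ by (intro elementary_cone_scaleR) auto
  qed (simp add: elementary_cone.zero)
  define y where "y = \<beta> - t *\<^sub>R theta a m - h *\<^sub>R P"
  have co_hP: "co (h *\<^sub>R P) b n =
      (if (b = a \<or> n = 0) \<and> (n = m - 1 \<or> n = m \<or> n = Suc m) then h else 0)"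
    if n: "n \<le> len b" for b n
  proof (cases "m < len a")
    case True
    have "arm b n = arm a (m - 1) \<longleftrightarrow> n = m - 1 \<and> (b = a \<or> n = 0)"
      using m n by (subst arm_eq) auto
    moreover have "arm b n = arm a m \<longleftrightarrow> n = m \<and> b = a"
      using m n by (subst arm_eq) auto
    moreover have "arm b n = arm a (Suc m) \<longleftrightarrow> n = Suc m \<and> b = a"
      using m n True by (subst arm_eq) auto
    ultimately show ?thesis
      using n m by (auto simp: P_def co_def simple_root_nth)
  next
    case False
    then show ?thesis by (simp add: h_def co_linear)
  qed
  have co_tT: "co (t *\<^sub>R theta a m) b n = t *
      (if b = a \<or> n = 0 then if n = m then 1 else if n < m then 2 else 0 else if n = 1 then 1 else 0)"
    if "n \<le> len b" for b n
    using branched co_theta[OF _ m that] by (cases "t = 0") (auto simp: co_linear)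
  have near: "co y a (m - 1) = 0" "co y a m = 0"
    using m co_m co_hP[of "m - 1" a] co_hP[of m a] co_tT[of "m - 1" a] co_tT[of m a]
    by (auto simp: y_def co_linear(2))
  have next_zero: "co y a (Suc m) = 0"
    using m co_hP[of "Suc m" a] co_tT[of "Suc m" a]
    by (cases "Suc m \<le> len a") (auto simp: y_def co_linear(2) h_def)
  have nonneg: "0 \<le> co y b n" if n: "n \<le> len b" for b n
  proof (cases "(b = a \<or> n = 0) \<and> (n = m - 1 \<or> n = m \<or> n = Suc m)")
    case True
    then have "co y b n = co y a n" by auto
    then show ?thesis using near next_zero True by auto
  next
    case False
    then have "co (h *\<^sub>R P) b n = 0" unfolding co_hP[OF n] by (rule if_not_P)
    then have y: "co y b n = co \<beta> b n - co (t *\<^sub>R theta a m) b n"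
      by (simp add: y_def co_linear(2))
    show ?thesis
    proof (cases "t = 0")
      case True
      then show ?thesis using y co_nonneg[OF \<beta>(2)] by (simp add: co_linear)
    next
      case False
      then have t1: "1 \<le> slope \<beta> a m" using t0 tZ unfolding t_def by (auto elim!: Ints_cases)
      have "2 * t \<le> co \<beta> b n" if "b = a \<or> n = 0" "n < m"
        using co_ge_inward[OF \<beta> m t1 that(2)] that(1) by (auto simp: t_def)
      moreover have "t \<le> co \<beta> b 1"
        using co_ge_other_arm[OF \<beta> m t1 branched[OF False]] by (simp add: t_def)
      moreover have "0 \<le> co \<beta> b n" by (rule co_nonneg[OF \<beta>(2)])
      ultimately show ?thesis
        unfolding y co_tT[OF n] using \<open>\<not> (_ \<and> _)\<close> by auto
    qed
  qed
  have "y \<in> elementary_cone adj (arm a m)"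
  proof (rule elementary_cone_nonadjacent)
    show "0 \<le> y" unfolding less_eq_vec_def
      using nonneg cover by (metis co_def zero_index)
    have "co y b n \<in> \<int>" if n: "n \<le> len b" for b n
      unfolding y_def co_linear(2) co_hP[OF n] co_tT[OF n]
      using R_lattice[OF \<beta>(1)] tZ by (intro Ints_diff Ints_mult) (auto simp: Ints_co h_def)
    then show "lattice_vec y" unfolding lattice_vec_def using cover by (metis co_def)
    show "y $ arm a m = 0" using near(2) m by (simp add: co_def)
    fix j assume "adj (arm a m) j"
    then have "j \<in> neighbours adj (arm a m)" by (simp add: neighbours_def)
    then show "y $ j = 0"
      using near(1) next_zero m by (auto simp: neighbours_arm[OF m] co_def split: if_splits)
  qed
  then have "t *\<^sub>R theta a m + (h *\<^sub>R P + y) \<in> elementary_cone adj (arm a m)"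
    by (intro elementary_cone_add tT hP)
  then show ?thesis by (simp add: y_def)
qed

theorem orthogonal_root_in_cone:
  assumes "\<beta> \<in> R" "0 \<le> \<beta>" "B (simple_root i) \<beta> = 0"
  shows "\<beta> \<in> elementary_cone adj i"
  using assms orthogonal_root_in_cone_center orthogonal_root_in_cone_arm
  by (cases i rule: arm_cases) auto

end

section \<open>The cone and the lattice spanned by the canonical basis\<close>

lemma finite_canonical_basis: "finite (canonical_basis adj)" for adj :: "'n::finite graph"
proof -
  define E where "E = range (simple_root :: 'n \<Rightarrow> real ^ 'n)
    \<union> range (\<lambda>(h, i, j). simple_root h + simple_root i + simple_root j)
    \<union> range (\<lambda>S. highest_root_D adj S)"
  have "elementary adj i y \<Longrightarrow> y \<in> E" for i y
    by (induction rule: elementary.induct) (auto simp: E_def image_iff)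
  then have "canonical_basis adj \<subseteq> (\<lambda>(i, y). simple_root i \<or>\<^sub>2 y) ` (UNIV \<times> E)"
    by (auto simp: canonical_basis_def)
  moreover have "finite E" by (simp add: E_def)
  ultimately show ?thesis by (meson finite_SigmaI finite finite_imageI finite_subset)
qed

definition canonical_cone :: "'n::finite graph \<Rightarrow> (real ^ 'n ^ 'n) set" where
  "canonical_cone adj =
     {\<Sum>b\<in>canonical_basis adj. of_int (f b) *\<^sub>R b | f :: real ^ 'n ^ 'n \<Rightarrow> int. \<forall>b. 0 \<le> f b}"

lemma canonical_cone_add:
  assumes "x \<in> canonical_cone adj" "y \<in> canonical_cone adj"
  shows "x + y \<in> canonical_cone adj"
proof -
  obtain f g where "x = (\<Sum>b\<in>canonical_basis adj. of_int (f b) *\<^sub>R b)" "\<forall>b. 0 \<le> f b"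
    "y = (\<Sum>b\<in>canonical_basis adj. of_int (g b) *\<^sub>R b)" "\<forall>b. 0 \<le> g b"
    using assms unfolding canonical_cone_def by blast
  then have "x + y = (\<Sum>b\<in>canonical_basis adj. of_int (f b + g b) *\<^sub>R b)" "\<forall>b. 0 \<le> f b + g b"
    by (simp_all add: sum.distrib scaleR_add_left)
  then show ?thesis
    unfolding canonical_cone_def by (intro CollectI exI[of _ "\<lambda>b. f b + g b"]) auto
qed

lemma canonical_cone_zero: "0 \<in> canonical_cone adj"
  unfolding canonical_cone_def by (rule CollectI, rule exI[of _ "\<lambda>_. 0"]) simp

lemma canonical_basis_subset_cone:
  assumes "b \<in> canonical_basis adj"
  shows "b \<in> canonical_cone adj"
proof -
  have "(\<Sum>b'\<in>canonical_basis adj. of_int (if b' = b then 1 else 0) *\<^sub>R b')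
      = (\<Sum>b'\<in>canonical_basis adj. if b' = b then b' else 0)"
    by (intro sum.cong) auto
  also have "\<dots> = b" using assms by (subst sum.delta) (auto simp: finite_canonical_basis)
  finally show ?thesis
    unfolding canonical_cone_def
    by (intro CollectI exI[of _ "\<lambda>b'. if b' = b then 1 else 0"]) auto
qed

lemma elementary_cone_vee:
  "y \<in> elementary_cone adj i \<Longrightarrow> simple_root i \<or>\<^sub>2 y \<in> canonical_cone adj"
proof (induction rule: elementary_cone.induct)
  case (add e y)
  then have "simple_root i \<or>\<^sub>2 e \<in> canonical_cone adj"
    by (intro canonical_basis_subset_cone) (auto simp: canonical_basis_def)
  with add show ?case by (simp add: vee_add_right canonical_cone_add)
qed (simp add: vee_zero_right canonical_cone_zero)

lemma canonical_lattice_add: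
  assumes "x \<in> canonical_lattice adj" "y \<in> canonical_lattice adj"
  shows "x + y \<in> canonical_lattice adj"
proof -
  obtain f g where "x = (\<Sum>b\<in>canonical_basis adj. of_int (f b) *\<^sub>R b)"
    "y = (\<Sum>b\<in>canonical_basis adj. of_int (g b) *\<^sub>R b)"
    using assms unfolding canonical_lattice_def by blast
  then have "x + y = (\<Sum>b\<in>canonical_basis adj. of_int (f b + g b) *\<^sub>R b)"
    by (simp add: sum.distrib scaleR_add_left)
  then show ?thesis
    unfolding canonical_lattice_def by (intro CollectI exI[of _ "\<lambda>b. f b + g b"]) auto
qed

lemma canonical_lattice_minus:
  assumes "x \<in> canonical_lattice adj"
  shows "- x \<in> canonical_lattice adj"
proof -
  obtain f where "x = (\<Sum>b\<in>canonical_basis adj. of_int (f b) *\<^sub>R b)"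
    using assms unfolding canonical_lattice_def by blast
  then have "- x = (\<Sum>b\<in>canonical_basis adj. of_int (- f b) *\<^sub>R b)"
    by (simp add: sum_negf)
  then show ?thesis
    unfolding canonical_lattice_def by (intro CollectI exI[of _ "\<lambda>b. - f b"]) auto
qed

lemma canonical_cone_subset_lattice: "canonical_cone adj \<subseteq> canonical_lattice adj"
  unfolding canonical_cone_def canonical_lattice_def by blast

lemma le2_cone:
  assumes "q1 \<in> canonical_lattice adj" "q2 \<in> canonical_lattice adj" "q2 - q1 \<in> canonical_cone adj"
  shows "le2 adj q1 q2"
proof -
  obtain f where "q2 - q1 = (\<Sum>b\<in>canonical_basis adj. of_int (f b) *\<^sub>R b)" "\<forall>b. 0 \<le> f b"
    using assms(3) unfolding canonical_cone_def by blast
  then show ?thesis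
    using assms(1,2) unfolding le2_def by (intro conjI exI[of _ "\<lambda>b. of_int (f b)"]) auto
qed

context positive_diagram
begin

text \<open>
  A reflection moves a 2-root by a 2-root with a simple factor, and \<open>shift\<close> is the other factor.
  For orthogonal positive roots other than \<open>simple_root i\<close> it is a root unless both are fixed,
  and its sign tells whether the pair is raised or lowered.
\<close>

definition shift :: "'n \<Rightarrow> real ^ 'n \<Rightarrow> real ^ 'n \<Rightarrow> real ^ 'n" where
  "shift i x y = (B (simple_root i) x * B (simple_root i) y) *\<^sub>R simple_root i
     - B (simple_root i) x *\<^sub>R y - B (simple_root i) y *\<^sub>R x"

lemma vee_reflection: "s i x \<or>\<^sub>2 s i y = x \<or>\<^sub>2 y + simple_root i \<or>\<^sub>2 shift i x y"
  by (simp add: vec_eq_iff vee_nth simple_reflection_def shift_def algebra_simps)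

lemma shift_orthogonal: "B (simple_root i) (shift i x y) = 0"
  by (simp add: shift_def form_linear)

lemma B_simple_bound:
  assumes "x \<in> R" "0 \<le> x" "x \<noteq> simple_root i"
  shows "B (simple_root i) x \<in> {-1, 0, 1}"
proof -
  have "B (simple_root i) x \<in> \<int>" using R_lattice[OF assms(1)] by (simp add: Ints_form)
  moreover have "B (simple_root i) x \<le> 1" using R_B_le[of "simple_root i" x] assms by auto
  moreover have "0 \<le> simple_root i" by (simp add: less_eq_vec_def simple_root_nth)
  then have "-1 \<le> B (simple_root i) x" using R_pos_B_ge[of "simple_root i" x] assms by auto
  ultimately show ?thesis by (auto elim!: Ints_cases)
qed

lemma shift_R:
  assumes "x \<in> R" "y \<in> R" "B x y = 0"
    and "B (simple_root i) x \<in> {-1, 0, 1}" "B (simple_root i) y \<in> {-1, 0, 1}"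
    and "B (simple_root i) x \<noteq> 0 \<or> B (simple_root i) y \<noteq> 0"
  shows "shift i x y \<in> R"
proof -
  let ?a = "B (simple_root i) x" and ?b = "B (simple_root i) y"
  have ab: "?a \<in> \<int>" "?b \<in> \<int>" using assms(1,2) R_lattice by (simp_all add: Ints_form)
  have "lattice_vec (shift i x y)"
    unfolding shift_def using assms(1,2) R_lattice ab
    by (intro lattice_vec_diff lattice_vec_scaleR Ints_mult) auto
  moreover have "B (shift i x y) (shift i x y) = 2 * ?a\<^sup>2 + 2 * ?b\<^sup>2 - 2 * ?a\<^sup>2 * ?b\<^sup>2"
    using assms(3) R_norm[OF assms(1)] R_norm[OF assms(2)]
    by (simp add: shift_def form_linear B_sym[of x "simple_root i"] B_sym[of y "simple_root i"]
        B_sym[of y x] power2_eq_square algebra_simps)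
  moreover have "2 * ?a\<^sup>2 + 2 * ?b\<^sup>2 - 2 * ?a\<^sup>2 * ?b\<^sup>2 = 2" using assms(4-6) by auto
  ultimately show ?thesis by (simp add: R_def)
qed

end

context star_diagram
begin

lemma simple_vee_in_cone:
  assumes "\<beta> \<in> R" "0 \<le> \<beta>" "B (simple_root i) \<beta> = 0"
  shows "simple_root i \<or>\<^sub>2 \<beta> \<in> canonical_cone adj"
  using elementary_cone_vee orthogonal_root_in_cone[OF assms] by blast

lemma simple_vee_in_lattice:
  assumes "\<beta> \<in> R" "B (simple_root i) \<beta> = 0"
  shows "simple_root i \<or>\<^sub>2 \<beta> \<in> canonical_lattice adj"
proof (cases "0 \<le> \<beta>")
  case True
  then show ?thesis using simple_vee_in_cone assms canonical_cone_subset_lattice by blast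
next
  case False
  then have "0 \<le> - \<beta>" using R_sign[OF assms(1)] by auto
  then have "simple_root i \<or>\<^sub>2 (- \<beta>) \<in> canonical_lattice adj"
    using simple_vee_in_cone[of "- \<beta>" i] assms canonical_cone_subset_lattice
    by (auto simp: minus_R form_linear)
  then show ?thesis using canonical_lattice_minus by (fastforce simp: vee_minus_right)
qed

text \<open>
  Descent on the height of \<open>\<alpha>\<close>: a reflection that lowers \<open>\<alpha>\<close> changes the 2-root by a 2-root with
  a simple factor.
\<close>

theorem vee_in_lattice:
  assumes "\<alpha> \<in> R" "0 \<le> \<alpha>" "\<beta> \<in> R" "0 \<le> \<beta>" "B \<alpha> \<beta> = 0"
  shows "\<alpha> \<or>\<^sub>2 \<beta> \<in> canonical_lattice adj"
  using assms
proof (induction "nat \<lfloor>height \<alpha>\<rfloor>" arbitrary: \<alpha> \<beta> rule: less_induct)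
  case less
  show ?case
  proof (cases "\<exists>i. \<alpha> = simple_root i")
    case True
    then show ?thesis using less.prems simple_vee_in_lattice by auto
  next
    case False
    obtain i where i: "0 < B (simple_root i) \<alpha>" using R_pos_obtain_simple less.prems by blast
    have a: "B (simple_root i) \<alpha> = 1"
      using B_simple_bound[of \<alpha> i] less.prems False i by fastforce
    have "\<beta> \<noteq> simple_root i" using less.prems(5) i B_sym[of \<alpha> "simple_root i"] by auto
    then have b: "B (simple_root i) \<beta> \<in> {-1, 0, 1}" and pos: "0 \<le> s i \<beta>"
      using B_simple_bound s_R_pos less.prems by blast+
    have pos': "0 \<le> s i \<alpha>" using s_R_pos less.prems False by blast
    have R: "s i \<alpha> \<in> R" "s i \<beta> \<in> R" using s_R less.prems by blast+
    have "height (s i \<alpha>) = height \<alpha> - 1"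
      by (simp add: simple_reflection_def a height_diff)
    moreover have "0 < height (s i \<alpha>)" using height_pos pos' R R_nonzero by blast
    ultimately have "nat \<lfloor>height (s i \<alpha>)\<rfloor> < nat \<lfloor>height \<alpha>\<rfloor>" by linarith
    then have "s i \<alpha> \<or>\<^sub>2 s i \<beta> \<in> canonical_lattice adj"
      using less.prems(5) by (intro less.hyps R pos pos') (auto simp: B_s)
    moreover have "- (simple_root i \<or>\<^sub>2 shift i \<alpha> \<beta>) \<in> canonical_lattice adj"
      using a b less.prems
      by (intro canonical_lattice_minus simple_vee_in_lattice shift_R shift_orthogonal) auto
    ultimately have "(s i \<alpha> \<or>\<^sub>2 s i \<beta>) + - (simple_root i \<or>\<^sub>2 shift i \<alpha> \<beta>) \<in> canonical_lattice adj"
      by (rule canonical_lattice_add)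
    then show ?thesis by (simp add: vee_reflection)
  qed
qed

section \<open>Linear independence of the canonical basis\<close>

definition entry :: "real ^ 'n ^ 'n \<Rightarrow> 3 \<Rightarrow> nat \<Rightarrow> nat \<Rightarrow> real" where
  "entry M a p q = (if p \<le> len a \<and> q \<le> len a then M $ arm a p $ arm a q else 0)"

text \<open>
  Mixed second differences along the outer part of an arm; halved, since \<open>x \<or>\<^sub>2 y\<close> contains both
  tensor products. They turn a 2-root into a sum of products of slopes.
\<close>

definition tau :: "3 \<Rightarrow> nat \<Rightarrow> real ^ 'n ^ 'n \<Rightarrow> real" where
  "tau a m M = (\<Sum>n=m..len a. (entry M a n n - entry M a n (Suc n) - entry M a (Suc n) n
     + entry M a (Suc n) (Suc n)) / 2)"

lemma linear_tau: "linear (tau a m)"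
proof (rule linearI)
  have "entry (M + N) a p q = entry M a p q + entry N a p q"
    and "entry (r *\<^sub>R M) a p q = r * entry M a p q" for M N r p q
    by (simp_all add: entry_def)
  then show "tau a m (M + N) = tau a m M + tau a m N" "tau a m (r *\<^sub>R M) = r *\<^sub>R tau a m M" for M N r
    by (simp_all add: tau_def sum_distrib_left algebra_simps
        add_divide_distrib diff_divide_distrib flip: sum.distrib)
qed

lemma tau_vee: "tau a m (x \<or>\<^sub>2 y) = (\<Sum>n=m..len a. slope x a n * slope y a n)"
proof -
  have "entry (x \<or>\<^sub>2 y) a p q = co x a p * co y a q + co y a p * co x a q" for p q
    by (simp add: entry_def co_def vee_nth)
  then show ?thesis
    unfolding tau_def by (intro sum.cong) (auto simp: slope_def field_simps)
qed

text \<open>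
  The slopes of a simple root are \<open>1\<close> and \<open>-1\<close> on the two sides of its vertex. Away from the centre,
  orthogonality says that \<open>y\<close> has equal slopes on both sides, so the contributions cancel unless
  the sum starts between them.
\<close>

lemma tau_simple:
  assumes "B (simple_root i) y = 0" "m \<le> len a"
  shows "tau a m (simple_root i \<or>\<^sub>2 y) = (if i = arm a m then slope y a m else 0)"
proof (cases "\<exists>l \<le> len a. i = arm a l")
  case True
  then obtain l where l: "l \<le> len a" "i = arm a l" by blast
  have "co (simple_root i) a n = (if n = l then 1 else 0)" for n
    using l by (cases "n \<le> len a") (auto simp: co_def simple_root_nth arm_eq)
  then have "slope (simple_root i) a n * slope y a n
      = (if n = l then slope y a n else 0) - (if n = l - 1 \<and> 1 \<le> l then slope y a n else 0)" for n
    by (auto simp: slope_def)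
  then have "tau a m (simple_root i \<or>\<^sub>2 y) = (\<Sum>n=m..len a. if n = l then slope y a n else 0)
      - (\<Sum>n=m..len a. if n = l - 1 \<and> 1 \<le> l then slope y a n else 0)"
    by (simp only: tau_vee sum_subtractf)
  also have "\<dots> = (if m \<le> l then slope y a l else 0)
      - (if 1 \<le> l \<and> m \<le> l - 1 then slope y a (l - 1) else 0)"
    using l by (cases "1 \<le> l") auto
  also have "\<dots> = (if l = m then slope y a m else 0)"
    using assms(1) l form_simple_arm[of l a y] by auto
  also have "l = m \<longleftrightarrow> i = arm a m" using l assms(2) by (auto simp: arm_eq)
  finally show ?thesis .
next
  case False
  then have "co (simple_root i) a n = 0" for n
    by (auto simp: co_def simple_root_nth)
  then show ?thesis using False assms(2) by (auto simp: tau_vee slope_def)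
qed

lemma elementary_arm_cases:
  assumes "elementary adj (arm a m) y" and m: "1 \<le> m" "m \<le> len a"
  obtains (simple) j where "j \<noteq> arm a m" "\<not> adj (arm a m) j" "y = simple_root j"
      "slope y a m = 0" "co y a (Suc m) = 0"
  | (path) "m < len a" "y = simple_root (arm a (m - 1)) + simple_root (arm a m) + simple_root (arm a (Suc m))"
      "slope y a m = 0" "co y a (Suc m) = 1"
  | (branch) "\<And>b. 0 < len b" "y = theta a m" "slope y a m = 1" "co y a (Suc m) = 0"
  using assms(1)
proof (cases rule: elementary_star_cases)
  case (simple j)
  have "co y a m = 0" using simple m by (simp add: co_def simple_root_nth)
  moreover have "co y a (Suc m) = 0"
    using simple m adj_arm[of m a "Suc m" a] by (auto simp: co_def simple_root_nth)
  ultimately show ?thesis using that(1) simple by (simp add: slope_def)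
next
  case (path h j)
  have "h \<in> neighbours adj (arm a m)" "j \<in> neighbours adj (arm a m)"
    using path star_sym by (auto simp: neighbours_def)
  then have lt: "m < len a" and hj: "{h, j} = {arm a (m - 1), arm a (Suc m)}"
    using path(3) unfolding neighbours_arm[OF m] by (auto split: if_splits)
  have "arm a (Suc m) \<noteq> arm a m" "arm a (Suc m) \<noteq> arm a (m - 1)" "arm a m \<noteq> arm a (m - 1)"
    using m lt by (subst arm_eq; auto)+
  moreover have y: "y = simple_root (arm a (m - 1)) + simple_root (arm a m) + simple_root (arm a (Suc m))"
    using path(4) hj by (auto simp: doubleton_eq_iff add_ac)
  ultimately have "co y a m = 1" "co y a (Suc m) = 1"
    using lt by (auto simp: co_def simple_root_nth)
  then show ?thesis using that(2)[OF lt y] by (simp add: slope_def)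
next
  case (branch a' m')
  then have "m' = m" "a' = a" using m by (auto simp: arm_eq)
  moreover have "co (theta a m) a (Suc m) = 0"
    using co_theta[OF branch(1) m, of "Suc m" a] by (cases "Suc m \<le> len a") auto
  ultimately show ?thesis using that(3) branch slope_theta[OF branch(1) m] by simp
qed

lemma elementary_center_cases:
  assumes "elementary adj c y"
  obtains (simple) j where "j \<noteq> c" "\<not> adj c j" "y = simple_root j"
  | (path) a b where "a \<noteq> b" "0 < len a" "0 < len b"
      "y = simple_root (arm a 1) + simple_root c + simple_root (arm b 1)"
  using assms
proof (cases rule: elementary_star_cases)
  case (path h j)
  then have "h \<in> neighbours adj c" "j \<in> neighbours adj c"
    using star_sym by (auto simp: neighbours_def)
  then obtain a b where ab: "h = arm a 1" "0 < len a" "j = arm b 1" "0 < len b"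
    unfolding neighbours_center by blast
  then have "a \<noteq> b" using path(3) by blast
  then show ?thesis using path(4) ab that(2) by blast
next
  case (branch a m)
  then show ?thesis using neq_center by metis
qed (use that in auto)

text \<open>
  The condition that \<open>y\<close> is elementary with respect to \<open>i\<close> through the branch vertex.
\<close>

definition branch_pair :: "'n \<Rightarrow> real ^ 'n \<Rightarrow> bool" where
  "branch_pair i y \<longleftrightarrow>
     (\<forall>b. 0 < len b) \<and> (\<exists>a m. 1 \<le> m \<and> m \<le> len a \<and> i = arm a m \<and> y = theta a m)"

lemma simple_root_not_branch_pair: "\<not> branch_pair i (simple_root j)"
proof
  assume "branch_pair i (simple_root j)"
  then obtain a m where am: "\<And>b. 0 < len b" "1 \<le> m" "m \<le> len a" "simple_root j = theta a m"
    by (auto simp: branch_pair_def)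
  have "co (theta a m) a 0 = 2" using co_theta[OF am(1-3), of 0 a] am(2) by simp
  then show False by (simp flip: am(4) add: simple_root_nth split: if_splits)
qed

text \<open>
  The functional extracts the coefficient of the branch element at \<open>k\<close>, weighted by the entry
  which that element contributes at \<open>(k, l)\<close>.
\<close>

lemma branch_coefficient_functional:
  obtains G :: "real ^ 'n ^ 'n \<Rightarrow> real" where "linear G"
    "\<And>i y. elementary adj i y \<Longrightarrow>
      G (simple_root i \<or>\<^sub>2 y) = (if i = k \<and> branch_pair i y then y $ l else 0)"
proof (cases k rule: arm_cases)
  case 1
  have "\<not> (i = c \<and> branch_pair i y)" for i y using neq_center by (metis branch_pair_def)
  then show ?thesis using 1 by (intro that[of "\<lambda>_. 0"]) (auto simp: linear_iff)
next
  case (2 a m)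
  define G where "G M = tau a m M * theta a m $ l" for M
  have "linear G"
    using linear_tau[of a m] by (simp add: linear_iff G_def algebra_simps)
  moreover have "G (simple_root i \<or>\<^sub>2 y) = (if i = k \<and> branch_pair i y then y $ l else 0)"
    if el: "elementary adj i y" for i y
  proof -
    have tau: "tau a m (simple_root i \<or>\<^sub>2 y) = (if i = arm a m then slope y a m else 0)"
      by (rule tau_simple[OF elementary_orthogonal[OF el] 2(3)])
    show ?thesis
    proof (cases "i = arm a m")
      case True
      have not_branch: "\<not> branch_pair i y" if "slope y a m = 0"
      proof
        assume "branch_pair i y"
        then obtain a' m' where b: "\<And>b. 0 < len b" "m' \<le> len a'" "i = arm a' m'" "y = theta a' m'"
          by (auto simp: branch_pair_def)
        then have "a' = a" "m' = m" using True 2 by (auto simp: arm_eq)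
        then show False using slope_theta[OF b(1) 2(2,3)] b(4) that by simp
      qed
      show ?thesis
        using el[unfolded True] 2(2,3)
      proof (cases rule: elementary_arm_cases)
        case branch
        then have "branch_pair i y" using True 2 by (auto simp: branch_pair_def)
        then show ?thesis using branch tau True 2 by (simp add: G_def)
      qed (use not_branch tau in \<open>auto simp: G_def\<close>)
    qed (use tau 2 in \<open>auto simp: G_def\<close>)
  qed
  ultimately show ?thesis using that by blast
qed

text \<open>
  At a vertex of an arm, \<open>tau\<close> detects the branch element and the remainder of the diagonal entry
  the path element. At the centre, \<open>tau\<close> of one arm detects the path through the other two. An
  entry at nonadjacent vertices detects a product of simple roots once the contribution of the
  branch elements is removed.
\<close>

lemma dual_functional:
  assumes el0: "elementary adj i0 y0"
  obtains F :: "real ^ 'n ^ 'n \<Rightarrow> real" where "linear F" "F (simple_root i0 \<or>\<^sub>2 y0) = 1"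
    "\<And>i y. elementary adj i y \<Longrightarrow> simple_root i \<or>\<^sub>2 y \<noteq> simple_root i0 \<or>\<^sub>2 y0 \<Longrightarrow>
      F (simple_root i \<or>\<^sub>2 y) = 0"
proof -
  note result = that
  have simple_case: thesis if j0: "j0 \<noteq> i0" "\<not> adj i0 j0" "y0 = simple_root j0" for j0
  proof -
    obtain G :: "real ^ 'n ^ 'n \<Rightarrow> real" where G: "linear G" "\<And>i y. elementary adj i y \<Longrightarrow>
        G (simple_root i \<or>\<^sub>2 y) = (if i = i0 \<and> branch_pair i y then y $ j0 else 0)"
      using branch_coefficient_functional by blast
    obtain H :: "real ^ 'n ^ 'n \<Rightarrow> real" where H: "linear H" "\<And>i y. elementary adj i y \<Longrightarrow>
        H (simple_root i \<or>\<^sub>2 y) = (if i = j0 \<and> branch_pair i y then y $ i0 else 0)"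
      using branch_coefficient_functional by blast
    define F where "F M = M $ i0 $ j0 - G M - H M" for M :: "real ^ 'n ^ 'n"
    have "linear F" using G(1) H(1) by (simp add: linear_iff F_def algebra_simps)
    have F: "F (simple_root i \<or>\<^sub>2 y) = (if branch_pair i y then 0
        else (if i = i0 then y $ j0 else 0) + (if i = j0 then y $ i0 else 0))"
      if "elementary adj i y" for i y
      using G(2)[OF that] H(2)[OF that] j0(1)
      by (auto simp: F_def vee_nth simple_root_nth)
    show thesis
    proof (rule result)
      show "linear F" by fact
      show "F (simple_root i0 \<or>\<^sub>2 y0) = 1"
        using F[OF el0] j0 simple_root_not_branch_pair by (simp add: simple_root_nth)
      fix i y assume el: "elementary adj i y" and neq: "simple_root i \<or>\<^sub>2 y \<noteq> simple_root i0 \<or>\<^sub>2 y0"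
      show "F (simple_root i \<or>\<^sub>2 y) = 0"
        using el
      proof (cases rule: elementary_star_cases)
        case (simple j)
        then have "\<not> (i = i0 \<and> j = j0)" "\<not> (i = j0 \<and> j = i0)"
          using neq j0(3) vee_commute by metis+
        then show ?thesis using F[OF el] simple j0(1) by (auto simp: simple_root_nth)
      next
        case (path h j)
        have "\<not> adj j0 i0" using j0 star_sym by blast
        then have "i = i0 \<Longrightarrow> y $ j0 = 0" "i = j0 \<Longrightarrow> y $ i0 = 0"
          using path j0 star_sym by (auto simp: simple_root_nth)
        then show ?thesis using F[OF el] by auto
      next
        case (branch a m)
        then have "branch_pair i y" by (auto simp: branch_pair_def)
        then show ?thesis using F[OF el] by simp
      qed
    qed
  qed
  show ?thesis
  proof (cases i0 rule: arm_cases)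
    case 1
    from el0 show ?thesis unfolding 1
    proof (cases rule: elementary_center_cases)
      case (simple j)
      then show ?thesis using simple_case 1 by blast
    next
      case (path a b)
      obtain d where d: "d \<noteq> a" "d \<noteq> b" and ds: "\<And>x. x = a \<or> x = b \<or> x = d"
      proof -
        have "\<exists>d. d \<noteq> a \<and> d \<noteq> b \<and> (\<forall>x. x = a \<or> x = b \<or> x = d)"
          using path(1) exhaust_3[of a] exhaust_3[of b]
          by (auto simp: forall_3 intro: exI[of _ 1] exI[of _ 2] exI[of _ 3])
        then show ?thesis using that by blast
      qed
      have tau: "tau d 0 (simple_root i \<or>\<^sub>2 y) = (if i = c then slope y d 0 else 0)"
        if "elementary adj i y" for i y
        using tau_simple[OF elementary_orthogonal[OF that], of 0 d] by (simp add: arm_0)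
      have slope: "slope (simple_root (arm a 1) + simple_root c + simple_root (arm b 1)) d 0
          = (if d = a \<or> d = b then 0 else 1)" if "a \<noteq> b" "0 < len a" "0 < len b" for a b d
        using that neq_center[of 1 a] neq_center[of 1 b] neq_center[of 1 d]
        by (auto simp: slope_def co_def arm_0 simple_root_nth arm_eq Suc_le_eq)
      show ?thesis
      proof (rule result)
        show "linear (tau d 0)" by (rule linear_tau)
        show "tau d 0 (simple_root i0 \<or>\<^sub>2 y0) = 1"
          using tau[OF el0] 1 d slope[OF path(1-3)] path(4) by simp
        fix i y assume el: "elementary adj i y" and neq: "simple_root i \<or>\<^sub>2 y \<noteq> simple_root i0 \<or>\<^sub>2 y0"
        show "tau d 0 (simple_root i \<or>\<^sub>2 y) = 0"
        proof (cases "i = c")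
          case True
          show ?thesis using el[unfolded True]
          proof (cases rule: elementary_center_cases)
            case (simple j)
            then have "arm d 1 \<noteq> j" if "0 < len d"
              using that unfolding neighbours_center[unfolded neighbours_def]
              using neighbours_center by (auto simp: neighbours_def)
            then have "slope y d 0 = 0"
              using simple by (auto simp: slope_def co_def simple_root_nth arm_0)
            then show ?thesis using tau[OF el] by simp
          next
            case path': (path a' b')
            have "d = a' \<or> d = b'"
            proof (rule ccontr)
              assume "\<not> ?thesis"
              then have "{a', b'} = {a, b}" using ds[of a'] ds[of b'] path'(1) path(1) by auto
              then have "y = y0" using path' path by (auto simp: doubleton_eq_iff add_ac)
              then show False using neq True 1 by simp
            qed
            then show ?thesis using tau[OF el] True slope[OF path'(1-3)] path'(4) by simp
          qed
        qed (use tau[OF el] in simp)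
      qed
    qed
  next
    case (2 a m)
    have tau: "tau a m (simple_root i \<or>\<^sub>2 y) = (if i = i0 then slope y a m else 0)"
      if "elementary adj i y" for i y
      unfolding 2(1) by (rule tau_simple[OF elementary_orthogonal[OF that] 2(3)])
    from el0 2(2,3) show ?thesis unfolding 2(1)
    proof (cases rule: elementary_arm_cases)
      case (simple j)
      then show ?thesis using simple_case 2(1) by blast
    next
      case path
      define F where "F M = M $ i0 $ i0 / 2 - tau a m M" for M
      have F: "F (simple_root i \<or>\<^sub>2 y) = (if i = i0 then co y a (Suc m) else 0)"
        if "elementary adj i y" for i y
        using tau[OF that] 2 by (auto simp: F_def vee_nth simple_root_nth slope_def co_def)
      show ?thesis
      proof (rule result)
        show "linear F"
          using linear_tau[of a m] by (simp add: linear_iff F_def algebra_simps add_divide_distrib)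
        show "F (simple_root i0 \<or>\<^sub>2 y0) = 1" using F[OF el0] path by simp
        fix i y assume el: "elementary adj i y" and neq: "simple_root i \<or>\<^sub>2 y \<noteq> simple_root i0 \<or>\<^sub>2 y0"
        show "F (simple_root i \<or>\<^sub>2 y) = 0"
        proof (cases "i = i0")
          case True
          show ?thesis using el[unfolded True 2(1)] 2(2,3)
            by (cases rule: elementary_arm_cases) (use F[OF el] neq path True in auto)
        qed (use F[OF el] in simp)
      qed
    next
      case branch
      show ?thesis
      proof (rule result)
        show "linear (tau a m)" by (rule linear_tau)
        show "tau a m (simple_root i0 \<or>\<^sub>2 y0) = 1" using tau[OF el0] branch by simp
        fix i y assume el: "elementary adj i y" and neq: "simple_root i \<or>\<^sub>2 y \<noteq> simple_root i0 \<or>\<^sub>2 y0"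
        show "tau a m (simple_root i \<or>\<^sub>2 y) = 0"
        proof (cases "i = i0")
          case True
          show ?thesis using el[unfolded True 2(1)] 2(2,3)
            by (cases rule: elementary_arm_cases) (use tau[OF el] neq branch True in auto)
        qed (use tau[OF el] in simp)
      qed
    qed
  qed
qed

theorem canonical_basis_independent:
  assumes "(\<Sum>b\<in>canonical_basis adj. f b *\<^sub>R b) = 0" "b0 \<in> canonical_basis adj"
  shows "f b0 = 0"
proof -
  obtain i0 y0 where b0: "b0 = simple_root i0 \<or>\<^sub>2 y0" "elementary adj i0 y0"
    using assms(2) by (auto simp: canonical_basis_def)
  obtain F :: "real ^ 'n ^ 'n \<Rightarrow> real" where F: "linear F" "F b0 = 1"
    "\<And>b. b \<in> canonical_basis adj \<Longrightarrow> b \<noteq> b0 \<Longrightarrow> F b = 0"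
    using dual_functional[OF b0(2)] b0(1) unfolding canonical_basis_def by (smt (verit) mem_Collect_eq)
  have "0 = F (\<Sum>b\<in>canonical_basis adj. f b *\<^sub>R b)"
    using assms(1) linear_0[OF F(1)] by simp
  also have "\<dots> = (\<Sum>b\<in>canonical_basis adj. f b * F b)"
    by (simp add: linear_sum[OF F(1)] linear_scale[OF F(1)])
  also have "\<dots> = (\<Sum>b\<in>canonical_basis adj. if b = b0 then f b0 else 0)"
    using F(2,3) by (intro sum.cong) auto
  also have "\<dots> = f b0" using assms(2) by (subst sum.delta) (auto simp: finite_canonical_basis)
  finally show ?thesis by simp
qed

end

context positive_diagram
begin

section \<open>The Weyl group\<close>

lemma weyl_comp: "v \<in> weyl_group adj \<Longrightarrow> w \<in> weyl_group adj \<Longrightarrow> v \<circ> w \<in> weyl_group adj"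
  by (induction rule: weyl_group.induct) (auto simp: comp_assoc intro: weyl_group.step)

lemma weyl_reflection: "s i \<in> weyl_group adj"
  using weyl_group.step[OF weyl_group.one] by simp

lemma weyl_inverse:
  assumes "w \<in> weyl_group adj"
  obtains v where "v \<in> weyl_group adj" "\<And>x. v (w x) = x" "\<And>x. w (v x) = x"
proof -
  have "\<exists>v\<in>weyl_group adj. (\<forall>x. v (w x) = x) \<and> (\<forall>x. w (v x) = x)"
    using assms
  proof (induction rule: weyl_group.induct)
    case one
    show ?case by (rule bexI[OF _ weyl_group.one]) simp
  next
    case (step w i)
    then obtain v where v: "v \<in> weyl_group adj" "\<forall>x. v (w x) = x" "\<forall>x. w (v x) = x" by blast
    then show ?case
      by (intro bexI[of _ "v \<circ> s i"] weyl_comp weyl_reflection) auto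
  qed
  with that show ?thesis by blast
qed

lemma weyl_add: "w \<in> weyl_group adj \<Longrightarrow> w (x + y) = w x + w y"
  by (induction rule: weyl_group.induct) (auto simp: s_add)

lemma weyl_minus: "w \<in> weyl_group adj \<Longrightarrow> w (- x) = - w x"
  by (induction rule: weyl_group.induct) (auto simp: s_minus)

lemma weyl_B: "w \<in> weyl_group adj \<Longrightarrow> B (w x) (w y) = B x y"
  by (induction rule: weyl_group.induct) (auto simp: B_s)

lemma weyl_R: "w \<in> weyl_group adj \<Longrightarrow> x \<in> R \<Longrightarrow> w x \<in> R"
  by (induction rule: weyl_group.induct) (auto intro: s_R)

lemma roots_R: "x \<in> roots adj \<Longrightarrow> x \<in> R"
  using weyl_R by (auto simp: roots_def)

lemma roots_weyl: "w \<in> weyl_group adj \<Longrightarrow> x \<in> roots adj \<Longrightarrow> w x \<in> roots adj"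
  unfolding roots_def using weyl_comp[of w] by (auto simp: o_def)

text \<open>
  Conjugating a simple reflection by an element that carries its simple root to \<open>\<beta>\<close> gives the
  reflection in \<open>\<beta>\<close>.
\<close>

lemma root_reflection:
  assumes "\<beta> \<in> roots adj"
  obtains t where "t \<in> weyl_group adj" "t \<beta> = - \<beta>" "\<And>x. B x \<beta> = 0 \<Longrightarrow> t x = x"
proof -
  obtain w k where w: "w \<in> weyl_group adj" "\<beta> = w (simple_root k)"
    using assms by (auto simp: roots_def)
  obtain v where v: "v \<in> weyl_group adj" "\<And>x. v (w x) = x" "\<And>x. w (v x) = x"
    using weyl_inverse[OF w(1)] by blast
  show ?thesis
  proof (rule that[of "w \<circ> (s k \<circ> v)"])
    show "w \<circ> (s k \<circ> v) \<in> weyl_group adj" by (intro weyl_comp weyl_reflection w v)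
    have "s k (simple_root k) = - simple_root k"
      by (simp add: simple_reflection_def scaleR_2)
    then show "(w \<circ> (s k \<circ> v)) \<beta> = - \<beta>" using w v by (simp add: weyl_minus)
    fix x assume "B x \<beta> = 0"
    then have "B (simple_root k) (v x) = 0"
      using weyl_B[OF w(1), of "v x" "simple_root k"] w(2) v(3) B_sym by simp
    then have "s k (v x) = v x" by (simp add: simple_reflection_def)
    then show "(w \<circ> (s k \<circ> v)) x = x" by (simp add: v)
  qed
qed

lemma roots_minus:
  assumes "x \<in> roots adj"
  shows "- x \<in> roots adj"
  using root_reflection[OF assms] roots_weyl assms by metis

section \<open>Dominant vectors\<close>

definition dominant :: "real ^ 'n \<Rightarrow> bool" where
  "dominant x \<longleftrightarrow> (\<forall>i. 0 \<le> B (simple_root i) x)"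

definition ascend :: "real ^ 'n \<Rightarrow> real ^ 'n \<Rightarrow> bool" where
  "ascend x y \<longleftrightarrow> (\<exists>i. B (simple_root i) x < 0 \<and> y = s i x)"

text \<open>A termination measure for ascents, which increase the height and preserve the norm.\<close>

definition rank_above :: "real ^ 'n \<Rightarrow> nat" where
  "rank_above x = card {y. lattice_vec y \<and> B y y = B x x \<and> height x < height y}"

lemma s_lattice: "lattice_vec x \<Longrightarrow> lattice_vec (s i x)"
  by (simp add: simple_reflection_def lattice_vec_diff lattice_vec_scaleR Ints_form)

lemma ascendI: "B (simple_root i) x < 0 \<Longrightarrow> ascend x (s i x)"
  by (auto simp: ascend_def)

lemma ascend_lattice: "ascend x y \<Longrightarrow> lattice_vec x \<Longrightarrow> lattice_vec y"
  by (auto simp: ascend_def s_lattice)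

lemma ascend_rank:
  assumes "ascend x y" "lattice_vec x"
  shows "rank_above y < rank_above x"
proof -
  obtain i where i: "B (simple_root i) x < 0" "y = s i x" using assms by (auto simp: ascend_def)
  have B: "B y y = B x x" by (simp add: i B_s)
  have h: "height x < height y"
    using i by (simp add: simple_reflection_def height_diff height_scaleR)
  show ?thesis
    unfolding rank_above_def
  proof (rule psubset_card_mono)
    show "finite {y. lattice_vec y \<and> B y y = B x x \<and> height x < height y}"
      by (rule finite_subset[OF _ finite_lattice_norm[of "B x x"]]) auto
    show "{z. lattice_vec z \<and> B z z = B y y \<and> height y < height z}
        \<subset> {z. lattice_vec z \<and> B z z = B x x \<and> height x < height z}"
      using B h ascend_lattice[OF assms] by (auto simp: psubset_eq)
  qed
qed

lemma ascend_to_dominant: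
  assumes "lattice_vec x"
  obtains d where "ascend\<^sup>*\<^sup>* x d" "dominant d"
proof -
  have "\<exists>d. ascend\<^sup>*\<^sup>* x d \<and> dominant d"
    using assms
  proof (induction "rank_above x" arbitrary: x rule: less_induct)
    case less
    show ?case
    proof (cases "dominant x")
      case False
      then obtain i where "B (simple_root i) x < 0" by (auto simp: dominant_def not_le)
      then have "ascend x (s i x)" by (auto simp: ascend_def)
      then show ?thesis
        using less ascend_rank ascend_lattice by (metis converse_rtranclp_into_rtranclp)
    qed blast
  qed
  with that show ?thesis by blast
qed

lemma B_simple_s: "B (simple_root j) (s i x) = B (simple_root j) x - B (simple_root i) x * cartan adj j i"
  by (simp add: simple_reflection_def form_linear form_simple_simple)

text \<open>
  Two ascents from the same vector are joined inside the rank two group generated by their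
  reflections, by the braid relation.
\<close>

lemma ascend_joinable:
  assumes "ascend x y" "ascend x z"
  obtains u where "ascend\<^sup>*\<^sup>* y u" "ascend\<^sup>*\<^sup>* z u"
proof -
  obtain i j where i: "B (simple_root i) x < 0" "y = s i x" and j: "B (simple_root j) x < 0" "z = s j x"
    using assms by (auto simp: ascend_def)
  consider "i = j" | "i \<noteq> j" "\<not> adj i j" | "i \<noteq> j" "adj i j" by blast
  then show ?thesis
  proof cases
    case 1
    then show ?thesis using that[of y] i j by simp
  next
    case 2
    then have c: "cartan adj i j = 0" "cartan adj j i = 0" using adj_sym by (auto simp: cartan_def)
    have "ascend y (s j y)" "ascend z (s i z)"
      using i j c by (auto intro!: ascendI simp: B_simple_s)
    moreover have "s j y = s i z"
      unfolding i(2) j(2) vec_eq_iff using 2(1) by (auto simp: s_nth B_simple_s c)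
    ultimately show ?thesis using that[of "s j y"] by auto
  next
    case 3
    then have c: "cartan adj i j = -1" "cartan adj j i = -1" using adj_sym by (auto simp: cartan_def)
    have c2: "cartan adj k k = 2" for k by (simp add: cartan_def)
    have "ascend y (s j y)" "ascend (s j y) (s i (s j y))" "ascend z (s i z)" "ascend (s i z) (s j (s i z))"
      using i j c by (auto intro!: ascendI simp: B_simple_s c2)
    moreover have "s i (s j y) = s j (s i z)"
      unfolding i(2) j(2) vec_eq_iff using 3(1) by (auto simp: s_nth B_simple_s c c2)
    ultimately show ?thesis
      using that[of "s i (s j y)"] by (metis converse_rtranclp_into_rtranclp r_into_rtranclp)
  qed
qed

text \<open>
  Newman's lemma: ascents terminate and are locally confluent, so all maximal chains of ascents
  from a vector end at the same dominant vector.
\<close>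

lemma ascend_unique:
  assumes "lattice_vec x" "ascend\<^sup>*\<^sup>* x d" "dominant d" "ascend\<^sup>*\<^sup>* x e" "dominant e"
  shows "d = e"
  using assms
proof (induction "rank_above x" arbitrary: x d e rule: less_induct)
  case less
  have stuck: "d = x" if "dominant x" "ascend\<^sup>*\<^sup>* x d" for d
    using that(2,1) by (cases rule: converse_rtranclpE) (auto simp: ascend_def dominant_def not_le[symmetric])
  show ?case
  proof (cases "dominant x")
    case True
    then show ?thesis using stuck less.prems by metis
  next
    case False
    then obtain y z where y: "ascend x y" "ascend\<^sup>*\<^sup>* y d" and z: "ascend x z" "ascend\<^sup>*\<^sup>* z e"
      using less.prems by (metis converse_rtranclpE)
    obtain u where u: "ascend\<^sup>*\<^sup>* y u" "ascend\<^sup>*\<^sup>* z u" using ascend_joinable y(1) z(1) by blast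
    have lat: "lattice_vec y" "lattice_vec z"
      using ascend_lattice y z less.prems(1) by blast+
    have "lattice_vec u" using u(1) lat(1)
      by (induction rule: rtranclp_induct) (auto intro: ascend_lattice)
    then obtain f where f: "ascend\<^sup>*\<^sup>* u f" "dominant f" using ascend_to_dominant by blast
    have "d = f"
      using less.hyps[OF ascend_rank[OF y(1) less.prems(1)] lat(1) y(2) less.prems(3) _ f(2)] u f
      by (meson rtranclp_trans)
    moreover have "e = f"
      using less.hyps[OF ascend_rank[OF z(1) less.prems(1)] lat(2) z(2) less.prems(5) _ f(2)] u f
      by (meson rtranclp_trans)
    ultimately show ?thesis by simp
  qed
qed

text \<open>
  Applying a simple reflection does not change the dominant end point of the ascents, because the
  reflected vector is an ascent of the original one, or conversely, or equal to it.
\<close>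

theorem dominant_unique:
  assumes "lattice_vec x" "dominant x" "w \<in> weyl_group adj" "dominant (w x)"
  shows "w x = x"
proof -
  have "lattice_vec (w x) \<and> ascend\<^sup>*\<^sup>* (w x) x"
    using assms(3)
  proof (induction rule: weyl_group.induct)
    case (step w i)
    let ?y = "w x"
    have lat: "lattice_vec (s i ?y)" using step s_lattice by blast
    consider "B (simple_root i) ?y < 0" | "B (simple_root i) ?y = 0" | "0 < B (simple_root i) ?y"
      by linarith
    then have "ascend\<^sup>*\<^sup>* (s i ?y) x"
    proof cases
      case 1
      then have "ascend ?y (s i ?y)" by (auto simp: ascend_def)
      moreover obtain d where d: "ascend\<^sup>*\<^sup>* (s i ?y) d" "dominant d"
        using ascend_to_dominant[OF lat] by blast
      ultimately have "ascend\<^sup>*\<^sup>* ?y d" by (simp add: converse_rtranclp_into_rtranclp)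
      then have "d = x" using ascend_unique[of ?y] step d(2) assms(2) by blast
      then show ?thesis using d by simp
    next
      case 2
      then show ?thesis using step by (simp add: simple_reflection_def)
    next
      case 3
      then have "B (simple_root i) (s i ?y) < 0" by (simp add: B_simple_s cartan_def)
      then have "ascend (s i ?y) ?y" unfolding ascend_def by (metis s_s)
      then show ?thesis using step by (simp add: converse_rtranclp_into_rtranclp)
    qed
    then show ?case using lat by simp
  qed (use assms in auto)
  then show ?thesis using ascend_unique[of "w x" "w x" x] assms by blast
qed

section \<open>Pairs that no reflection raises\<close>

text \<open>
  Simple roots that belong to the pair are exempt: their reflections fix the pair, because they
  only change a sign.
\<close>

definition locally_maximal :: "real ^ 'n \<Rightarrow> real ^ 'n \<Rightarrow> bool" where
  "locally_maximal \<alpha> \<beta> \<longleftrightarrow>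
     (\<forall>i. \<alpha> \<noteq> simple_root i \<longrightarrow> \<beta> \<noteq> simple_root i \<longrightarrow>
        B (simple_root i) \<alpha> \<noteq> 0 \<or> B (simple_root i) \<beta> \<noteq> 0 \<longrightarrow> \<not> 0 \<le> shift i \<alpha> \<beta>)"

definition orthogonal_pair :: "real ^ 'n \<Rightarrow> real ^ 'n \<Rightarrow> bool" where
  "orthogonal_pair \<alpha> \<beta> \<longleftrightarrow> \<alpha> \<in> R \<and> 0 \<le> \<alpha> \<and> \<beta> \<in> R \<and> 0 \<le> \<beta> \<and> B \<alpha> \<beta> = 0"

lemma orthogonal_pairD:
  assumes "orthogonal_pair \<alpha> \<beta>"
  shows "\<alpha> \<in> R" "0 \<le> \<alpha>" "\<beta> \<in> R" "0 \<le> \<beta>" "B \<alpha> \<beta> = 0"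
  using assms by (auto simp: orthogonal_pair_def)

lemma shift_commute: "shift i x y = shift i y x"
  by (simp add: shift_def algebra_simps)

lemma locally_maximal_commute: "locally_maximal \<alpha> \<beta> \<Longrightarrow> locally_maximal \<beta> \<alpha>"
  unfolding locally_maximal_def by (metis shift_commute)

lemma orthogonal_pair_commute: "orthogonal_pair \<alpha> \<beta> \<Longrightarrow> orthogonal_pair \<beta> \<alpha>"
  unfolding orthogonal_pair_def by (auto simp: B_sym)

text \<open>
  If a simple root is negative on \<open>\<alpha>\<close>, the reflection can fail to raise the pair only by being
  positive on \<open>\<beta>\<close>: in the other cases the shift is a sum of positive vectors.
\<close>

lemma locally_maximal_negative:
  assumes pair: "orthogonal_pair \<alpha> \<beta>" and "locally_maximal \<alpha> \<beta>" and neg: "B (simple_root i) \<alpha> < 0"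
  shows "B (simple_root i) \<alpha> = -1" "B (simple_root i) \<beta> = 1" "\<beta> \<le> \<alpha> + simple_root i"
proof -
  note p = orthogonal_pairD[OF pair]
  let ?b = "B (simple_root i) \<beta>"
  have neq: "\<alpha> \<noteq> simple_root i" using neg by auto
  moreover have neq': "\<beta> \<noteq> simple_root i" using neg p(5) B_sym[of \<alpha> \<beta>] by auto
  ultimately have ns: "\<not> 0 \<le> shift i \<alpha> \<beta>" using assms(2) neg by (auto simp: locally_maximal_def)
  have a: "B (simple_root i) \<alpha> = -1" using B_simple_bound[OF p(1,2) neq] neg by auto
  have b: "?b \<in> {-1, 0, 1}" using B_simple_bound[OF p(3,4) neq'] .
  have shift: "shift i \<alpha> \<beta> = \<beta> - ?b *\<^sub>R (\<alpha> + simple_root i)"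
    by (simp add: shift_def a algebra_simps)
  have pos: "0 \<le> \<alpha> + simple_root i" using p(2) by (simp add: less_eq_vec_def simple_root_nth)
  have "?b \<noteq> 0" using ns p(4) shift by auto
  moreover have "?b \<noteq> -1"
  proof
    assume "?b = -1"
    then have "shift i \<alpha> \<beta> = \<beta> + (\<alpha> + simple_root i)" using shift by simp
    then show False using ns p(4) pos by simp
  qed
  ultimately show "?b = 1" using b by auto
  then have "shift i \<alpha> \<beta> = \<beta> - (\<alpha> + simple_root i)" using shift by simp
  moreover have "shift i \<alpha> \<beta> \<in> R" using p a b by (intro shift_R) auto
  then have "shift i \<alpha> \<beta> \<le> 0" using ns R_sign by blast
  ultimately show "\<beta> \<le> \<alpha> + simple_root i" by simp
  show "B (simple_root i) \<alpha> = -1" by (rule a)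
qed

lemma locally_maximal_sum_dominant:
  assumes "orthogonal_pair \<alpha> \<beta>" "locally_maximal \<alpha> \<beta>"
  shows "dominant (\<alpha> + \<beta>)"
  unfolding dominant_def form_add_right
proof
  fix i
  show "0 \<le> B (simple_root i) \<alpha> + B (simple_root i) \<beta>"
    using locally_maximal_negative[OF assms, of i]
      locally_maximal_negative[OF orthogonal_pair_commute[OF assms(1)]
        locally_maximal_commute[OF assms(2)], of i] by linarith
qed

text \<open>
  A simple root negative on \<open>\<beta>\<close> would give \<open>\<alpha> - simple_root i \<le> \<beta>\<close>; pairing with the dominant
  vector \<open>\<alpha>\<close> turns this into \<open>1 \<le> 0\<close>.
\<close>

lemma locally_maximal_dominant:
  assumes "orthogonal_pair \<alpha> \<beta>" "locally_maximal \<alpha> \<beta>" "dominant \<alpha>"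
  shows "dominant \<beta>"
  unfolding dominant_def
proof (rule allI, rule ccontr)
  fix i assume "\<not> 0 \<le> B (simple_root i) \<beta>"
  note p = orthogonal_pairD[OF assms(1)]
  note neg = locally_maximal_negative[OF orthogonal_pair_commute[OF assms(1)]
        locally_maximal_commute[OF assms(2)], of i]
  have a: "B (simple_root i) \<alpha> = 1" and le: "\<alpha> \<le> \<beta> + simple_root i"
    using neg \<open>\<not> _\<close> by auto
  have "0 \<le> B (\<beta> + simple_root i - \<alpha>) \<alpha>"
  proof (rule B_dominant_mono)
    show "0 \<le> B (simple_root k) \<alpha>" for k using assms(3) by (simp add: dominant_def)
    show "0 \<le> \<beta> + simple_root i - \<alpha>" using le by simp
  qed
  also have "\<dots> = B \<beta> \<alpha> + B (simple_root i) \<alpha> - B \<alpha> \<alpha>"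
    by (simp only: form_add_left form_diff_left)
  also have "\<dots> = -1" using a p(5) R_norm[OF p(1)] B_sym[of \<beta> \<alpha>] by simp
  finally show False by simp
qed

text \<open>
  Dominance propagates the vanishing of a coefficient to the adjacent vertices, so by
  connectedness a dominant root has full support.
\<close>

lemma dominant_orthogonal_pair_absurd:
  assumes "orthogonal_pair \<alpha> \<beta>" "dominant \<alpha>" "dominant \<beta>"
  shows False
proof -
  note p = orthogonal_pairD[OF assms(1)]
  have nn: "0 \<le> \<alpha> $ k" for k using p(2) by (simp add: less_eq_vec_def)
  have closed: "\<alpha> $ k = 0" if "\<alpha> $ j = 0" "adj j k" for j k
  proof -
    have "0 \<le> B (simple_root j) \<alpha>" using assms(2) by (simp add: dominant_def)
    then have "(\<Sum>k\<in>neighbours adj j. \<alpha> $ k) \<le> 0"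
      using that(1) form_simple_neighbours[of adj j \<alpha>] adj_irrefl by simp
    then have "(\<Sum>k\<in>neighbours adj j. \<alpha> $ k) = 0" using nn by (simp add: antisym sum_nonneg)
    then show ?thesis using that(2) nn by (simp add: sum_nonneg_eq_0_iff neighbours_def)
  qed
  have full: "\<alpha> $ k \<noteq> 0" for k
  proof
    assume "\<alpha> $ k = 0"
    then have "{k. \<alpha> $ k = 0} = UNIV" using closed by (intro connected[of k]) auto
    then have "\<alpha> = 0" by (auto simp: vec_eq_iff)
    then show False using R_nonzero[OF p(1)] by simp
  qed
  have "(\<Sum>k\<in>UNIV. \<alpha> $ k * B (simple_root k) \<beta>) = 0"
    using p(5) by (simp add: form_expand_left[of adj \<alpha>])
  then have "B (simple_root k) \<beta> = 0" for k
    using nn full assms(3) by (subst (asm) sum_nonneg_eq_0_iff) (auto simp: dominant_def)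
  then have "B \<beta> \<beta> = 0" by (simp add: form_expand_left[of adj \<beta>])
  then show False using R_norm[OF p(3)] by simp
qed

text \<open>
  Neither member is dominant, so some simple root is negative on \<open>\<alpha>\<close> and another on \<open>\<beta>\<close>. The two
  differences \<open>\<alpha> + simple_root i - \<beta>\<close> and \<open>\<beta> + simple_root j - \<alpha>\<close> are then positive with sum
  \<open>simple_root i + simple_root j\<close>, which leaves a single possibility.
\<close>

lemma locally_maximal_difference:
  assumes pair: "orthogonal_pair \<alpha> \<beta>" and max: "locally_maximal \<alpha> \<beta>"
  obtains i j where "i \<noteq> j" "\<alpha> - \<beta> = simple_root j - simple_root i"
proof -
  note p = orthogonal_pairD[OF pair]
  note pair' = orthogonal_pair_commute[OF pair] and max' = locally_maximal_commute[OF max]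
  have "\<not> dominant \<alpha>"
    using locally_maximal_dominant[OF pair max] dominant_orthogonal_pair_absurd[OF pair] by blast
  then obtain i where "B (simple_root i) \<alpha> < 0" by (auto simp: dominant_def not_le)
  note i = locally_maximal_negative[OF pair max this]
  have "\<not> dominant \<beta>"
    using locally_maximal_dominant[OF pair' max'] dominant_orthogonal_pair_absurd[OF pair'] by blast
  then obtain j where "B (simple_root j) \<beta> < 0" by (auto simp: dominant_def not_le)
  note j = locally_maximal_negative[OF pair' max' this]
  have "i \<noteq> j" using i j by auto
  define \<zeta> where "\<zeta> = \<alpha> + simple_root i - \<beta>"
  define \<xi> where "\<xi> = \<beta> + simple_root j - \<alpha>"
  have sum: "\<zeta> $ k + \<xi> $ k = simple_root i $ k + simple_root j $ k" for k
    by (simp add: \<zeta>_def \<xi>_def)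
  have nn: "0 \<le> \<zeta> $ k" "0 \<le> \<xi> $ k" for k
    using i(3) j(3) by (simp_all add: \<zeta>_def \<xi>_def less_eq_vec_def)
  have lat: "lattice_vec \<zeta>"
    unfolding \<zeta>_def using R_lattice p by (intro lattice_vec_add lattice_vec_diff) auto
  have norms: "B \<zeta> \<zeta> = 2" "B \<xi> \<xi> = 2"
    using i(1,2) j(1,2) p(5) R_norm[OF p(1)] R_norm[OF p(3)]
    by (simp_all add: \<zeta>_def \<xi>_def form_linear B_sym[of \<alpha> "simple_root i"] B_sym[of \<beta> "simple_root i"]
        B_sym[of \<alpha> "simple_root j"] B_sym[of \<beta> "simple_root j"] B_sym[of \<beta> \<alpha>])
  have i\<zeta>: "B (simple_root i) \<zeta> = 0" using i(1,2) by (simp add: \<zeta>_def form_linear)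
  have zero: "\<zeta> $ k = 0" if "k \<noteq> i" "k \<noteq> j" for k
    using sum[of k] nn[of k] that by (simp add: simple_root_nth)
  have bit_all: "\<zeta> $ k \<in> \<int> \<and> \<zeta> $ k \<le> 1" for k
    using lat sum[of k] nn[of k] \<open>i \<noteq> j\<close> by (auto simp: lattice_vec_def simple_root_nth split: if_splits)
  have bit: "\<zeta> $ k = 0 \<or> \<zeta> $ k = 1" for k
  proof -
    obtain z where "\<zeta> $ k = of_int z" using bit_all by (meson Ints_cases)
    then show ?thesis using bit_all nn(1)[of k] by (metis of_int_0_le_iff of_int_le_1_iff
      of_int_0 of_int_1 int_one_le_iff_zero_less order_le_less order_antisym)
  qed
  have "\<zeta> \<noteq> 0" using norms by (auto simp: form_linear)
  moreover have "\<zeta> \<noteq> simple_root i" using i\<zeta> by auto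
  moreover have "\<zeta> \<noteq> simple_root i + simple_root j"
  proof
    assume "\<zeta> = simple_root i + simple_root j"
    then have "\<xi> = 0" using sum by (simp add: vec_eq_iff)
    then show False using norms by (simp add: form_linear)
  qed
  moreover have "\<zeta> = (\<zeta> $ i) *\<^sub>R simple_root i + (\<zeta> $ j) *\<^sub>R simple_root j"
    using zero \<open>i \<noteq> j\<close> by (auto simp: vec_eq_iff simple_root_nth)
  ultimately have "\<zeta> = simple_root j" using bit[of i] bit[of j] by auto
  then have "\<alpha> - \<beta> = simple_root j - simple_root i" by (simp add: \<zeta>_def algebra_simps)
  with \<open>i \<noteq> j\<close> that show ?thesis by blast
qed

text \<open>
  From \<open>\<alpha> - \<beta> = simple_root j - simple_root i\<close> the odd coefficients of \<open>\<alpha> + \<beta>\<close> are those at \<open>i\<close>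
  and \<open>j\<close>, so the sum of the pair determines its difference up to sign.
\<close>

lemma locally_maximal_determined_by_sum:
  assumes "orthogonal_pair \<alpha> \<beta>" "locally_maximal \<alpha> \<beta>"
    and "orthogonal_pair \<alpha>' \<beta>'" "locally_maximal \<alpha>' \<beta>'"
    and sum: "\<alpha> + \<beta> = \<alpha>' + \<beta>'"
  shows "{\<alpha>, \<beta>} = {\<alpha>', \<beta>'}"
proof -
  obtain i j where ij: "i \<noteq> j" "\<alpha> - \<beta> = simple_root j - simple_root i"
    using locally_maximal_difference[OF assms(1,2)] by blast
  obtain k l where kl: "k \<noteq> l" "\<alpha>' - \<beta>' = simple_root l - simple_root k"
    using locally_maximal_difference[OF assms(3,4)] by blast
  have \<beta>: "\<beta> = \<alpha> + simple_root i - simple_root j" "\<beta>' = \<alpha>' + simple_root k - simple_root l"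
    using ij(2) kl(2) by (simp_all add: algebra_simps)
  have parity: "((simple_root i - simple_root j) $ x - (simple_root k - simple_root l) $ x) / 2 \<in> \<int>" for x
  proof -
    have "((simple_root i - simple_root j) $ x - (simple_root k - simple_root l) $ x) / 2
        = \<alpha>' $ x - \<alpha> $ x"
      using arg_cong[OF sum, of "\<lambda>v. v $ x"] unfolding \<beta> by simp
    also have "\<dots> \<in> \<int>"
      using R_lattice assms(1,3) by (auto simp: lattice_vec_def orthogonal_pair_def)
    finally show ?thesis .
  qed
  have half: "(1 / 2 :: real) \<notin> \<int>" "(- 1 / 2 :: real) \<notin> \<int>"
    by (auto elim!: Ints_cases)
  have "{k, l} = {i, j}"
    using parity[of i] parity[of j] half ij(1) kl(1)
    by (auto simp: simple_root_nth split: if_splits)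
  then have "k = i \<and> l = j \<or> k = j \<and> l = i" by (auto simp: doubleton_eq_iff)
  moreover have "\<beta> - \<alpha> = simple_root i - simple_root j"
    using arg_cong[OF ij(2), of uminus] by simp
  ultimately have "\<alpha>' - \<beta>' = \<alpha> - \<beta> \<or> \<alpha>' - \<beta>' = \<beta> - \<alpha>"
    using ij(2) kl(2) by metis
  then show ?thesis
  proof
    assume "\<alpha>' - \<beta>' = \<alpha> - \<beta>"
    with sum have "\<alpha>' = \<alpha>" "\<beta>' = \<beta>" by (auto simp: vec_eq_iff) (smt (verit))+
    then show ?thesis by simp
  next
    assume "\<alpha>' - \<beta>' = \<beta> - \<alpha>"
    with sum have "\<alpha>' = \<beta>" "\<beta>' = \<alpha>" by (auto simp: vec_eq_iff) (smt (verit))+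
    then show ?thesis by auto
  qed
qed

end

section \<open>The maximum of an orbit\<close>

lemma sum_entries_vee: "(\<Sum>k\<in>UNIV. \<Sum>l\<in>UNIV. (x \<or>\<^sub>2 y) $ k $ l) = 2 * height x * height y"
proof -
  have "(\<Sum>k\<in>UNIV. \<Sum>l\<in>UNIV. x $ k * y $ l) = height x * height y" for x y :: "real ^ 'a"
    by (simp add: height_def sum_product)
  then show ?thesis by (simp add: vee_nth sum.distrib)
qed

context star_diagram
begin

text \<open>
  Among the finitely many pairs above the given one choose one with the largest product of
  heights. This product is half the sum of the entries of the 2-root, so a further raise would
  increase it. The predicate \<open>P\<close> stands for membership in an orbit.
\<close>

lemma raise_to_locally_maximal:
  assumes "orthogonal_pair \<alpha> \<beta>" "P \<alpha> \<beta>"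
    and P_step: "\<And>\<alpha> \<beta> i. P \<alpha> \<beta> \<Longrightarrow> orthogonal_pair \<alpha> \<beta> \<Longrightarrow> \<alpha> \<noteq> simple_root i \<Longrightarrow> \<beta> \<noteq> simple_root i \<Longrightarrow>
      P (s i \<alpha>) (s i \<beta>)"
  obtains \<alpha>' \<beta>' where "orthogonal_pair \<alpha>' \<beta>'" "P \<alpha>' \<beta>'" "locally_maximal \<alpha>' \<beta>'"
    "\<alpha>' \<or>\<^sub>2 \<beta>' - \<alpha> \<or>\<^sub>2 \<beta> \<in> canonical_cone adj"
proof -
  define T where "T = {(x, y). orthogonal_pair x y \<and> P x y \<and> x \<or>\<^sub>2 y - \<alpha> \<or>\<^sub>2 \<beta> \<in> canonical_cone adj}"
  define f where "f = (\<lambda>(x :: real ^ 'n, y :: real ^ 'n). height x * height y)"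
  have "T \<subseteq> R \<times> R" by (auto simp: T_def orthogonal_pair_def)
  then have fin: "finite T" by (rule finite_subset) (simp add: finite_R)
  have "(\<alpha>, \<beta>) \<in> T" using assms(1,2) by (simp add: T_def canonical_cone_zero)
  then have "Max (f ` T) \<in> f ` T" using fin by (intro Max_in) auto
  then obtain x y where xy: "(x, y) \<in> T" "f (x, y) = Max (f ` T)" by auto
  have le: "f z \<le> f (x, y)" if "z \<in> T" for z
    unfolding xy(2) using fin that by (intro Max_ge) auto
  have pair: "orthogonal_pair x y" and P: "P x y"
    and cone: "x \<or>\<^sub>2 y - \<alpha> \<or>\<^sub>2 \<beta> \<in> canonical_cone adj"
    using xy(1) by (auto simp: T_def)
  note p = orthogonal_pairD[OF pair]
  have "locally_maximal x y"
    unfolding locally_maximal_def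
  proof (intro allI impI notI)
    fix i
    assume neq: "x \<noteq> simple_root i" "y \<noteq> simple_root i"
      and nonzero: "B (simple_root i) x \<noteq> 0 \<or> B (simple_root i) y \<noteq> 0"
      and pos: "0 \<le> shift i x y"
    have R: "shift i x y \<in> R"
      using p neq nonzero by (intro shift_R B_simple_bound) auto
    have pair': "orthogonal_pair (s i x) (s i y)"
      using p neq by (auto simp: orthogonal_pair_def B_s intro: s_R s_R_pos)
    have "(x \<or>\<^sub>2 y - \<alpha> \<or>\<^sub>2 \<beta>) + simple_root i \<or>\<^sub>2 shift i x y \<in> canonical_cone adj"
      by (intro canonical_cone_add cone simple_vee_in_cone R pos shift_orthogonal)
    then have "(s i x, s i y) \<in> T"
      using pair' P_step[OF P pair neq] by (simp add: T_def vee_reflection algebra_simps)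
    then have "height (s i x) * height (s i y) \<le> height x * height y"
      using le[of "(s i x, s i y)"] by (simp add: f_def)
    moreover have "2 * height (s i x) * height (s i y)
        = 2 * height x * height y + 2 * height (simple_root i :: real ^ 'n) * height (shift i x y)"
      unfolding sum_entries_vee[symmetric] vee_reflection by (simp add: sum.distrib)
    moreover have "0 < height (shift i x y)" using height_pos[OF pos] R_nonzero[OF R] by blast
    ultimately show False by simp
  qed
  then show ?thesis using that pair P cone by blast
qed

theorem orbit_maximum:
  assumes "X \<in> pair_orbits adj"
  obtains \<alpha> \<beta> where "{\<alpha>, \<beta>} \<in> X" "\<And>\<rho>. \<rho> \<in> X \<Longrightarrow> pair_le2 adj \<rho> {\<alpha>, \<beta>}"
proof -
  obtain \<alpha>0 \<beta>0 where X: "X = (\<lambda>w. pair_act adj w {\<alpha>0, \<beta>0}) ` weyl_group adj"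
    and pos0: "\<alpha>0 \<in> pos_roots adj" "\<beta>0 \<in> pos_roots adj" and orth0: "B \<alpha>0 \<beta>0 = 0"
    using assms unfolding pair_orbits_def orth_pairs_def by blast
  have root0: "\<alpha>0 \<in> roots adj" "\<beta>0 \<in> roots adj" using pos0 by (auto simp: pos_roots_def)
  have pos_iff: "x \<in> pos_roots adj \<longleftrightarrow> x \<in> roots adj \<and> 0 \<le> x" for x
    by (auto simp: pos_roots_def less_eq_vec_def)
  have sign: "x \<in> pos_roots adj \<or> - x \<in> pos_roots adj" if "x \<in> roots adj" for x
    using R_sign[OF roots_R[OF that]] that roots_minus by (auto simp: pos_iff)
  have not_both: "- x \<notin> pos_roots adj" if "x \<in> pos_roots adj" for x
    using R_pos_neq_minus[of "- x" x] that roots_R minus_R by (auto simp: pos_iff)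
  \<comment> \<open>The members of the orbit, as ordered pairs whose signs have been corrected.\<close>
  define P where "P \<alpha> \<beta> \<longleftrightarrow> \<alpha> \<in> pos_roots adj \<and> \<beta> \<in> pos_roots adj \<and>
    (\<exists>w\<in>weyl_group adj. (\<alpha> = w \<alpha>0 \<or> \<alpha> = - w \<alpha>0) \<and> (\<beta> = w \<beta>0 \<or> \<beta> = - w \<beta>0))" for \<alpha> \<beta>
  have act: "pair_act adj w {\<alpha>0, \<beta>0} = {\<alpha>, \<beta>}"
    if "\<alpha> \<in> pos_roots adj" "\<beta> \<in> pos_roots adj" "\<alpha> = w \<alpha>0 \<or> \<alpha> = - w \<alpha>0" "\<beta> = w \<beta>0 \<or> \<beta> = - w \<beta>0"
    for w \<alpha> \<beta>
    unfolding pair_act_def using that not_both[of \<alpha>] not_both[of \<beta>] by auto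
  have P_X: "{\<alpha>, \<beta>} \<in> X" if "P \<alpha> \<beta>" for \<alpha> \<beta>
    using that act unfolding P_def X by blast
  have X_P: "\<exists>\<alpha> \<beta>. \<rho> = {\<alpha>, \<beta>} \<and> P \<alpha> \<beta>" if \<rho>: "\<rho> \<in> X" for \<rho>
  proof -
    obtain w where w: "w \<in> weyl_group adj" "\<rho> = pair_act adj w {\<alpha>0, \<beta>0}" using \<rho> X by blast
    obtain \<alpha> where \<alpha>: "\<alpha> \<in> pos_roots adj" "\<alpha> = w \<alpha>0 \<or> \<alpha> = - w \<alpha>0"
      using sign[OF roots_weyl[OF w(1) root0(1)]] by blast
    obtain \<beta> where \<beta>: "\<beta> \<in> pos_roots adj" "\<beta> = w \<beta>0 \<or> \<beta> = - w \<beta>0"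
      using sign[OF roots_weyl[OF w(1) root0(2)]] by blast
    show ?thesis using act[OF \<alpha>(1) \<beta>(1) \<alpha>(2) \<beta>(2)] w \<alpha> \<beta> unfolding P_def by blast
  qed
  have P_pair: "orthogonal_pair \<alpha> \<beta>" if P: "P \<alpha> \<beta>" for \<alpha> \<beta>
  proof -
    obtain w where w: "w \<in> weyl_group adj" "\<alpha> = w \<alpha>0 \<or> \<alpha> = - w \<alpha>0" "\<beta> = w \<beta>0 \<or> \<beta> = - w \<beta>0"
      using P unfolding P_def by blast
    have "B (w \<alpha>0) (w \<beta>0) = 0" using weyl_B[OF w(1)] orth0 by simp
    then have "B \<alpha> \<beta> = 0" using w(2,3) by (auto simp: form_linear)
    then show ?thesis using that roots_R by (auto simp: P_def pos_iff orthogonal_pair_def)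
  qed
  have P_step: "P (s i \<alpha>) (s i \<beta>)"
    if P: "P \<alpha> \<beta>" "orthogonal_pair \<alpha> \<beta>" "\<alpha> \<noteq> simple_root i" "\<beta> \<noteq> simple_root i" for \<alpha> \<beta> i
  proof -
    obtain w where w: "w \<in> weyl_group adj" "\<alpha> = w \<alpha>0 \<or> \<alpha> = - w \<alpha>0" "\<beta> = w \<beta>0 \<or> \<beta> = - w \<beta>0"
      and pos: "\<alpha> \<in> pos_roots adj" "\<beta> \<in> pos_roots adj"
      using P(1) unfolding P_def by blast
    have "s i \<alpha> \<in> pos_roots adj" "s i \<beta> \<in> pos_roots adj"
      using pos P s_R_pos roots_weyl[OF weyl_reflection]
      by (auto simp: pos_iff orthogonal_pair_def)
    moreover have "s i \<circ> w \<in> weyl_group adj" using w(1) by (rule weyl_group.step)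
    moreover have "s i \<alpha> = (s i \<circ> w) \<alpha>0 \<or> s i \<alpha> = - (s i \<circ> w) \<alpha>0"
      "s i \<beta> = (s i \<circ> w) \<beta>0 \<or> s i \<beta> = - (s i \<circ> w) \<beta>0"
      using w(2,3) by (auto simp: s_minus)
    ultimately show ?thesis unfolding P_def by blast
  qed
  \<comment> \<open>The reflections in the two roots change signs, so all sums lie in one orbit.\<close>
  have sums: "\<exists>u\<in>weyl_group adj. \<alpha> + \<beta> = u (\<alpha>0 + \<beta>0)" if P: "P \<alpha> \<beta>" for \<alpha> \<beta>
  proof -
    obtain w where w: "w \<in> weyl_group adj" "\<alpha> = w \<alpha>0 \<or> \<alpha> = - w \<alpha>0" "\<beta> = w \<beta>0 \<or> \<beta> = - w \<beta>0"
      using P unfolding P_def by blast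
    obtain t where t: "t \<in> weyl_group adj" "t \<alpha>0 = - \<alpha>0" "t \<beta>0 = \<beta>0"
      using root_reflection[OF root0(1)] orth0 B_sym by metis
    obtain t' where t': "t' \<in> weyl_group adj" "t' \<beta>0 = - \<beta>0" "t' \<alpha>0 = \<alpha>0"
      using root_reflection[OF root0(2)] orth0 by metis
    obtain a where a: "a \<in> weyl_group adj" "w (a \<alpha>0) = \<alpha>" "a \<beta>0 = \<beta>0"
      using w(2)
    proof
      assume "\<alpha> = w \<alpha>0" then show ?thesis using that[OF weyl_group.one] t by simp
    next
      assume "\<alpha> = - w \<alpha>0" then show ?thesis using that[of t] t weyl_minus[OF w(1)] by simp
    qed
    obtain b where b: "b \<in> weyl_group adj" "b \<alpha>0 = \<alpha>0" "w (b \<beta>0) = \<beta>"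
      using w(3)
    proof
      assume "\<beta> = w \<beta>0" then show ?thesis using that[OF weyl_group.one] t' by simp
    next
      assume "\<beta> = - w \<beta>0" then show ?thesis using that[of t'] t' weyl_minus[OF w(1)] by simp
    qed
    have "a (b \<beta>0) = b \<beta>0"
    proof -
      have "b \<beta>0 = \<beta>0 \<or> b \<beta>0 = - \<beta>0"
      proof -
        obtain v where "v \<in> weyl_group adj" and v: "\<And>x. v (w x) = x" and "\<And>x. w (v x) = x"
          by (rule weyl_inverse[OF w(1)], rule that)
        have inj: "x = y" if "w x = w y" for x y
          using arg_cong[OF that, of v] by (simp only: v)
        have "w (b \<beta>0) = w \<beta>0 \<or> w (b \<beta>0) = w (- \<beta>0)" using b(3) w(3) weyl_minus[OF w(1)] by simp
        then show ?thesis using inj by blast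
      qed
      then show ?thesis using a weyl_minus[OF a(1)] by auto
    qed
    then have "\<alpha> + \<beta> = (w \<circ> (a \<circ> b)) (\<alpha>0 + \<beta>0)"
      using a b w(1) by (simp add: weyl_add)
    moreover have "w \<circ> (a \<circ> b) \<in> weyl_group adj" by (intro weyl_comp w a b)
    ultimately show ?thesis by blast
  qed
  have unique: "{\<alpha>, \<beta>} = {\<alpha>', \<beta>'}"
    if m: "P \<alpha> \<beta>" "locally_maximal \<alpha> \<beta>" "P \<alpha>' \<beta>'" "locally_maximal \<alpha>' \<beta>'" for \<alpha> \<beta> \<alpha>' \<beta>'
  proof -
    obtain u u' where u: "u \<in> weyl_group adj" "\<alpha> + \<beta> = u (\<alpha>0 + \<beta>0)"
      "u' \<in> weyl_group adj" "\<alpha>' + \<beta>' = u' (\<alpha>0 + \<beta>0)" using sums m by metis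
    obtain v where v: "v \<in> weyl_group adj" "\<And>x. v (u x) = x" "\<And>x. u (v x) = x"
      by (rule weyl_inverse[OF u(1)], rule that)
    have conj: "(u' \<circ> v) (\<alpha> + \<beta>) = \<alpha>' + \<beta>'"
      unfolding u(2,4) comp_apply v(2) ..
    have dom: "dominant (\<alpha> + \<beta>)" "dominant (\<alpha>' + \<beta>')"
      using locally_maximal_sum_dominant P_pair m by blast+
    have "lattice_vec (\<alpha> + \<beta>)"
      using P_pair[OF m(1)] by (simp add: orthogonal_pair_def lattice_vec_add R_lattice)
    then have "\<alpha>' + \<beta>' = \<alpha> + \<beta>"
      using dominant_unique[OF _ dom(1) weyl_comp[OF u(3) v(1)]] conj dom(2) by simp
    then show ?thesis
      using locally_maximal_determined_by_sum[OF P_pair[OF m(1)] m(2) P_pair[OF m(3)] m(4)] by simp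
  qed
  have "\<exists>w\<in>weyl_group adj. (\<alpha>0 = w \<alpha>0 \<or> \<alpha>0 = - w \<alpha>0) \<and> (\<beta>0 = w \<beta>0 \<or> \<beta>0 = - w \<beta>0)"
    by (rule bexI[OF _ weyl_group.one]) simp
  then have P0: "P \<alpha>0 \<beta>0" using pos0 by (simp add: P_def)
  obtain \<alpha> \<beta> where max: "P \<alpha> \<beta>" "locally_maximal \<alpha> \<beta>"
    using raise_to_locally_maximal[OF P_pair[OF P0] P0 P_step] by blast
  show ?thesis
  proof (rule that)
    show "{\<alpha>, \<beta>} \<in> X" by (rule P_X[OF max(1)])
    fix \<rho> assume "\<rho> \<in> X"
    then obtain \<gamma> \<delta> where \<rho>: "\<rho> = {\<gamma>, \<delta>}" "P \<gamma> \<delta>" using X_P by blast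
    obtain \<alpha>' \<beta>' where m: "P \<alpha>' \<beta>'" "locally_maximal \<alpha>' \<beta>'"
        "\<alpha>' \<or>\<^sub>2 \<beta>' - \<gamma> \<or>\<^sub>2 \<delta> \<in> canonical_cone adj"
      using raise_to_locally_maximal[OF P_pair[OF \<rho>(2)] \<rho>(2) P_step] by blast
    have "le2 adj (\<gamma> \<or>\<^sub>2 \<delta>) (\<alpha>' \<or>\<^sub>2 \<beta>')"
      using P_pair[OF \<rho>(2)] P_pair[OF m(1)] m(3)
      by (intro le2_cone vee_in_lattice) (auto simp: orthogonal_pair_def)
    moreover have "{\<alpha>, \<beta>} = {\<alpha>', \<beta>'}" by (rule unique[OF max m(1,2)])
    ultimately show "pair_le2 adj \<rho> {\<alpha>, \<beta>}" using \<rho>(1) unfolding pair_le2_def by blast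
  qed
qed

lemma pair_le2_coefficients:
  assumes "pair_le2 adj {\<alpha>', \<beta>'} {\<alpha>, \<beta>}"
    and "\<alpha> \<or>\<^sub>2 \<beta> = (\<Sum>b\<in>canonical_basis adj. \<mu> b *\<^sub>R b)"
    and "\<alpha>' \<or>\<^sub>2 \<beta>' = (\<Sum>b\<in>canonical_basis adj. l b *\<^sub>R b)"
    and b: "b \<in> canonical_basis adj"
  shows "l b \<le> \<mu> b"
proof -
  have vee_eq: "x \<or>\<^sub>2 y = x' \<or>\<^sub>2 y'" if "{x, y} = {x', y'}" for x y x' y' :: "real ^ 'n"
    using that vee_commute by (auto simp: doubleton_eq_iff)
  obtain \<alpha>1 \<beta>1 \<alpha>2 \<beta>2 where "{\<alpha>', \<beta>'} = {\<alpha>1, \<beta>1}" "{\<alpha>, \<beta>} = {\<alpha>2, \<beta>2}"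
    "le2 adj (\<alpha>1 \<or>\<^sub>2 \<beta>1) (\<alpha>2 \<or>\<^sub>2 \<beta>2)"
    using assms(1) unfolding pair_le2_def by blast
  then have "le2 adj (\<alpha>' \<or>\<^sub>2 \<beta>') (\<alpha> \<or>\<^sub>2 \<beta>)" using vee_eq by metis
  then obtain f where f: "\<forall>b\<in>canonical_basis adj. 0 \<le> f b"
    "\<alpha> \<or>\<^sub>2 \<beta> - \<alpha>' \<or>\<^sub>2 \<beta>' = (\<Sum>b\<in>canonical_basis adj. f b *\<^sub>R b)"
    unfolding le2_def by blast
  then have "(\<Sum>b\<in>canonical_basis adj. (\<mu> b - l b - f b) *\<^sub>R b) = 0"
    using assms(2,3) by (simp add: scaleR_diff_left sum_subtractf)
  from canonical_basis_independent[OF this b] show ?thesis using f(1) b by force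
qed

end

section \<open>Dynkin diagrams are stars\<close>

lemma star_diagramI:
  fixes adj :: "'n::finite graph" and c :: 'n
  assumes f: "bij_betw f UNIV {1..CARD('n)}" "\<And>i j. adj i j \<longleftrightarrow> G (f i) (f j)"
    and arm_0: "\<And>a. p a 0 = p 1 0"
    and range: "\<And>a m. m \<le> len a \<Longrightarrow> p a m \<in> {1..CARD('n)}"
    and cover: "\<And>x. x \<in> {1..CARD('n)} \<Longrightarrow> \<exists>a m. m \<le> len a \<and> x = p a m"
    and arm_eq: "\<And>a b m n. m \<le> len a \<Longrightarrow> n \<le> len b \<Longrightarrow> p a m = p b n \<longleftrightarrow> m = n \<and> (a = b \<or> m = 0)"
    and adj_arm: "\<And>a b m n. m \<le> len a \<Longrightarrow> n \<le> len b \<Longrightarrow>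
      G (p a m) (p b n) \<longleftrightarrow> (m = Suc n \<or> n = Suc m) \<and> (a = b \<or> m = 0 \<or> n = 0)"
    and "1 < (\<Sum>a\<in>UNIV. 1 / real (len a + 1))"
    and "(\<forall>a. 0 < len a) \<or> (\<forall>a. a \<noteq> 1 \<longrightarrow> len a = 0)"
  shows "star_diagram adj (inv f (p 1 0)) (\<lambda>a m. inv f (p a m)) len"
proof -
  have inj: "inj f" using f(1) by (simp add: bij_betw_def)
  have inv: "f (inv f x) = x" if "x \<in> {1..CARD('n)}" for x
    using f(1) that by (metis bij_betw_def f_inv_into_f)
  show ?thesis
  proof
    show "inv f (p a 0) = inv f (p 1 0)" for a using arm_0 by metis
    show "\<exists>a m. m \<le> len a \<and> x = inv f (p a m)" for x
      using cover[of "f x"] f(1) inj by (metis bij_betw_apply iso_tuple_UNIV_I inv_f_f)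
    fix m a n b assume "m \<le> len a" "n \<le> len b"
    then show "inv f (p a m) = inv f (p b n) \<longleftrightarrow> m = n \<and> (a = b \<or> m = 0)"
      and "adj (inv f (p a m)) (inv f (p b n)) \<longleftrightarrow>
        (m = Suc n \<or> n = Suc m) \<and> (a = b \<or> m = 0 \<or> n = 0)"
      using inv range arm_eq adj_arm f(2) by metis+
  qed (fact assms)+
qed

lemma star_A:
  fixes adj :: "'n::finite graph"
  assumes "labelled_as adj diagram_A"
  shows "\<exists>c arm len. star_diagram adj c arm len"
proof -
  obtain f where f: "bij_betw f UNIV {1..CARD('n)}" "\<And>i j. adj i j \<longleftrightarrow> diagram_A (f i) (f j)"
    using assms by (auto simp: labelled_as_def)
  define len :: "3 \<Rightarrow> nat" where "len a = (if a = 1 then CARD('n) - 1 else 0)" for a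
  have card: "0 < CARD('n)" by simp
  have "star_diagram adj (inv f (Suc 0)) (\<lambda>a m. inv f (Suc m)) len"
  proof (rule star_diagramI[where G = diagram_A and p = "\<lambda>a. Suc", OF f])
    show "Suc m \<in> {1..CARD('n)}" if "m \<le> len a" for a m
    proof -
      have "m \<le> CARD('n) - 1" using that by (auto simp: len_def split: if_splits)
      then have "Suc m \<le> CARD('n)" using card by linarith
      then show ?thesis by simp
    qed
    show "\<exists>a m. m \<le> len a \<and> x = Suc m" if "x \<in> {1..CARD('n)}" for x
      using that by (intro exI[of _ 1] exI[of _ "x - 1"]) (auto simp: len_def)
    show "Suc m = Suc n \<longleftrightarrow> m = n \<and> (a = b \<or> m = 0)" if "m \<le> len a" "n \<le> len b" for a b m n
      using that by (auto simp: len_def split: if_splits)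
    show "diagram_A (Suc m) (Suc n) \<longleftrightarrow> (m = Suc n \<or> n = Suc m) \<and> (a = b \<or> m = 0 \<or> n = 0)"
      if "m \<le> len a" "n \<le> len b" for a b m n
      using that by (auto simp: len_def diagram_A_def split: if_splits)
    show "1 < (\<Sum>a\<in>UNIV. 1 / real (len a + 1))"
      by (simp add: sum_3 len_def add_pos_pos)
    show "(\<forall>a. 0 < len a) \<or> (\<forall>a. a \<noteq> 1 \<longrightarrow> len a = 0)" by (simp add: len_def)
  qed simp
  then show ?thesis by blast
qed

lemma all_le_1: "(\<forall>m\<le>1::nat. P m) \<longleftrightarrow> P 0 \<and> P 1"
  and all_le_2: "(\<forall>m\<le>2::nat. P m) \<longleftrightarrow> P 0 \<and> P 1 \<and> P 2"
  by (auto simp: le_Suc_eq numeral_2_eq_2)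

text \<open>Vertex \<open>N - 2\<close> is the centre; the arms lead to \<open>1\<close>, to \<open>N - 1\<close> and to \<open>N\<close>.\<close>

lemma star_D:
  fixes adj :: "'n::finite graph"
  assumes "labelled_as adj (diagram_D CARD('n))" and n: "4 \<le> CARD('n)"
  shows "\<exists>c arm len. star_diagram adj c arm len"
proof -
  define N where "N = CARD('n)"
  obtain f where f: "bij_betw f UNIV {1..CARD('n)}" "\<And>i j. adj i j \<longleftrightarrow> diagram_D N (f i) (f j)"
    using assms(1) by (auto simp: labelled_as_def N_def)
  define len :: "3 \<Rightarrow> nat" where "len a = (if a = 1 then N - 3 else 1)" for a
  define p :: "3 \<Rightarrow> nat \<Rightarrow> nat" where
    "p a m = (if a = 1 \<or> m = 0 then N - 2 - m else if a = 2 then N - 1 else N)" for a m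
  have N: "4 \<le> N" using n by (simp add: N_def)
  have lens: "len 1 = N - 3" "len 2 = 1" "len 3 = 1" by (simp_all add: len_def)
  have ps: "p 1 m = N - 2 - m" "p 2 m = (if m = 0 then N - 2 else N - 1)"
    "p 3 m = (if m = 0 then N - 2 else N)" for m
    by (simp_all add: p_def)
  have "star_diagram adj (inv f (p 1 0)) (\<lambda>a m. inv f (p a m)) len"
  proof (rule star_diagramI[where G = "diagram_D N" and p = p, OF f])
    show "p a 0 = p 1 0" for a by (simp add: p_def)
    have "\<forall>a. \<forall>m\<le>len a. p a m \<in> {1..N}"
      unfolding forall_3 lens ps using N by auto
    then show "p a m \<in> {1..CARD('n)}" if "m \<le> len a" for a m
      using that by (simp add: N_def)
    show "\<exists>a m. m \<le> len a \<and> x = p a m" if x: "x \<in> {1..CARD('n)}" for x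
    proof -
      consider "x \<le> N - 2" "1 \<le> x" | "x = N - 1" | "x = N" using x by (fastforce simp: N_def)
      then show ?thesis
      proof cases
        case 1
        then show ?thesis by (intro exI[of _ 1] exI[of _ "N - 2 - x"]) (auto simp: lens ps)
      next
        case 2
        then show ?thesis by (intro exI[of _ 2] exI[of _ 1]) (auto simp: lens ps)
      next
        case 3
        then show ?thesis by (intro exI[of _ 3] exI[of _ 1]) (auto simp: lens ps)
      qed
    qed
    have "\<forall>a b. \<forall>m\<le>len a. \<forall>n\<le>len b. p a m = p b n \<longleftrightarrow> m = n \<and> (a = b \<or> m = 0)"
      unfolding forall_3 lens ps using N by (auto simp: le_Suc_eq)
    then show "p a m = p b n \<longleftrightarrow> m = n \<and> (a = b \<or> m = 0)" if "m \<le> len a" "n \<le> len b" for a b m n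
      using that by blast
    have line: "diagram_D N (N - 2 - m) (N - 2 - n) \<longleftrightarrow> m = Suc n \<or> n = Suc m"
      if "m \<le> N - 3" "n \<le> N - 3" for m n
    proof -
      define x y where "x = N - 2 - m" and "y = N - 2 - n"
      have xy: "x + m + 2 = N" "y + n + 2 = N" using that N by (simp_all add: x_def y_def)
      then have "diagram_D N x y \<longleftrightarrow> y = x + 1 \<or> x = y + 1"
        unfolding diagram_D_def doubleton_eq_iff by simp linarith
      also have "\<dots> \<longleftrightarrow> m = Suc n \<or> n = Suc m" using xy by linarith
      finally show ?thesis by (simp only: x_def y_def)
    qed
    have fork: "diagram_D N (N - 2 - m) k \<longleftrightarrow> m = 0" "diagram_D N k (N - 2 - m) \<longleftrightarrow> m = 0"
      if "m \<le> N - 3" "k = N - 1 \<or> k = N" for m k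
    proof -
      define x where "x = N - 2 - m"
      have "x + m + 2 = N" using that(1) N by (simp add: x_def)
      moreover from this that(2) have "k = x + m + 1 \<or> k = x + m + 2" by auto
      ultimately have "(diagram_D N x k \<longleftrightarrow> m = 0) \<and> (diagram_D N k x \<longleftrightarrow> m = 0)"
        unfolding diagram_D_def doubleton_eq_iff by auto
      then show "diagram_D N (N - 2 - m) k \<longleftrightarrow> m = 0" "diagram_D N k (N - 2 - m) \<longleftrightarrow> m = 0"
        by (simp_all only: x_def)
    qed
    have ends: "\<not> diagram_D N k l" if "k = N - 1 \<or> k = N" "l = N - 1 \<or> l = N" for k l
      using N that unfolding diagram_D_def doubleton_eq_iff by auto
    have on_line: "p a m = N - 2 - m" "m \<le> N - 3" if "m \<le> len a" "a = 1 \<or> m = 0" for a m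
      using that by (auto simp: p_def len_def)
    have off_line: "m = 1" "p a m = N - 1 \<or> p a m = N" if "m \<le> len a" "\<not> (a = 1 \<or> m = 0)" for a m
      using that by (auto simp: p_def len_def)
    show "diagram_D N (p a m) (p b n) \<longleftrightarrow> (m = Suc n \<or> n = Suc m) \<and> (a = b \<or> m = 0 \<or> n = 0)"
      if m: "m \<le> len a" and n: "n \<le> len b" for a b m n
    proof (cases "a = 1 \<or> m = 0"; cases "b = 1 \<or> n = 0")
      assume ab: "a = 1 \<or> m = 0" "b = 1 \<or> n = 0"
      show ?thesis
        unfolding on_line(1)[OF m ab(1)] on_line(1)[OF n ab(2)]
          line[OF on_line(2)[OF m ab(1)] on_line(2)[OF n ab(2)]]
        using ab by auto
    next
      assume ab: "a = 1 \<or> m = 0" "\<not> (b = 1 \<or> n = 0)"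
      show ?thesis
        unfolding on_line(1)[OF m ab(1)] fork(1)[OF on_line(2)[OF m ab(1)] off_line(2)[OF n ab(2)]]
        using ab off_line(1)[OF n ab(2)] by auto
    next
      assume ab: "\<not> (a = 1 \<or> m = 0)" "b = 1 \<or> n = 0"
      show ?thesis
        unfolding on_line(1)[OF n ab(2)] fork(2)[OF on_line(2)[OF n ab(2)] off_line(2)[OF m ab(1)]]
        using ab off_line(1)[OF m ab(1)] by auto
    next
      assume ab: "\<not> (a = 1 \<or> m = 0)" "\<not> (b = 1 \<or> n = 0)"
      show ?thesis
        using ends[OF off_line(2)[OF m ab(1)] off_line(2)[OF n ab(2)]]
          off_line(1)[OF m ab(1)] off_line(1)[OF n ab(2)] by simp
    qed
    show "1 < (\<Sum>a\<in>UNIV. 1 / real (len a + 1))"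
      using N by (simp add: sum_3 lens)
    show "(\<forall>a. 0 < len a) \<or> (\<forall>a. a \<noteq> 1 \<longrightarrow> len a = 0)" using N by (simp add: len_def)
  qed
  then show ?thesis by blast
qed

text \<open>Vertex \<open>4\<close> is the centre; the arms are \<open>5, \<dots>, N\<close>, then \<open>3, 1\<close>, then \<open>2\<close>.\<close>

lemma star_E:
  fixes adj :: "'n::finite graph"
  assumes "labelled_as adj diagram_E" and n: "CARD('n) \<in> {6, 7, 8}"
  shows "\<exists>c arm len. star_diagram adj c arm len"
proof -
  define N where "N = CARD('n)"
  obtain f where f: "bij_betw f UNIV {1..CARD('n)}" "\<And>i j. adj i j \<longleftrightarrow> diagram_E (f i) (f j)"
    using assms(1) by (auto simp: labelled_as_def)
  define len :: "3 \<Rightarrow> nat" where "len a = (if a = 1 then N - 4 else if a = 2 then 2 else 1)" for a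
  define p :: "3 \<Rightarrow> nat \<Rightarrow> nat" where
    "p a m = (if a = 1 \<or> m = 0 then 4 + m else if a = 3 then 2 else if m = 1 then 3 else 1)" for a m
  have N: "N \<in> {6, 7, 8}" using n by (simp add: N_def)
  have neq: "(2 :: 3) \<noteq> 1" "(3 :: 3) \<noteq> 1" "(3 :: 3) \<noteq> 2" by auto
  have lens: "len 1 = N - 4" "len 2 = 2" "len 3 = 1" by (simp_all add: len_def)
  have ps: "p 1 m = 4 + m" "p 2 m = (if m = 0 then 4 else if m = 1 then 3 else 1)"
    "p 3 m = (if m = 0 then 4 else 2)" for m
    by (simp_all add: p_def)
  have two: "m \<le> 2 \<longleftrightarrow> m = 0 \<or> m = 1 \<or> m = 2" for m :: nat by auto
  have "star_diagram adj (inv f (p 1 0)) (\<lambda>a m. inv f (p a m)) len"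
  proof (rule star_diagramI[where G = diagram_E and p = p, OF f])
    show "p a 0 = p 1 0" for a by (simp add: p_def)
    have "\<forall>a. \<forall>m\<le>len a. p a m \<in> {1..N}"
      unfolding forall_3 lens ps using N by auto
    then show "p a m \<in> {1..CARD('n)}" if "m \<le> len a" for a m
      using that by (simp add: N_def)
    show "\<exists>a m. m \<le> len a \<and> x = p a m" if x: "x \<in> {1..CARD('n)}" for x
    proof -
      consider "4 \<le> x" "x \<le> N" | "x = 3" | "x = 1" | "x = 2" using x by (fastforce simp: N_def)
      then show ?thesis
      proof cases
        case 1
        then show ?thesis by (intro exI[of _ 1] exI[of _ "x - 4"]) (auto simp: lens ps)
      next
        case 2
        then show ?thesis by (intro exI[of _ 2] exI[of _ 1]) (auto simp: lens ps)
      next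
        case 3
        then show ?thesis by (intro exI[of _ 2] exI[of _ 2]) (auto simp: lens ps)
      next
        case 4
        then show ?thesis by (intro exI[of _ 3] exI[of _ 1]) (auto simp: lens ps)
      qed
    qed
    have "\<forall>a b. \<forall>m\<le>len a. \<forall>n\<le>len b. p a m = p b n \<longleftrightarrow> m = n \<and> (a = b \<or> m = 0)"
      unfolding forall_3 lens ps using N by (auto simp: le_Suc_eq two)
    then show "p a m = p b n \<longleftrightarrow> m = n \<and> (a = b \<or> m = 0)" if "m \<le> len a" "n \<le> len b" for a b m n
      using that by blast
    have line: "diagram_E (4 + m) (4 + n) \<longleftrightarrow> m = Suc n \<or> n = Suc m" for m n
      unfolding diagram_E_def doubleton_eq_iff by auto
    have near: "diagram_E (4 + m) k \<longleftrightarrow> m = 0" "diagram_E k (4 + m) \<longleftrightarrow> m = 0"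
      if "k = 3 \<or> k = 2" for m k
      using that unfolding diagram_E_def doubleton_eq_iff by auto
    have far: "\<not> diagram_E (4 + m) 1" "\<not> diagram_E 1 (4 + m)" for m
      unfolding diagram_E_def doubleton_eq_iff by auto
    have rest: "diagram_E 1 3" "diagram_E 3 1" "\<not> diagram_E 1 2" "\<not> diagram_E 2 1"
      "\<not> diagram_E 2 3" "\<not> diagram_E 3 2" "\<not> diagram_E k k" for k
      unfolding diagram_E_def doubleton_eq_iff by auto
    note E = line line[of _ 0, simplified] line[of 0, simplified]
      near near[of _ 0, simplified] far far[of 0, simplified] rest
    have "\<forall>a b. \<forall>m\<le>len a. \<forall>n\<le>len b. diagram_E (p a m) (p b n) \<longleftrightarrow>
        (m = Suc n \<or> n = Suc m) \<and> (a = b \<or> m = 0 \<or> n = 0)"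
      unfolding forall_3 lens ps all_le_1 all_le_2
      using neq neq[symmetric] by (auto simp: E[unfolded One_nat_def])
    then show "diagram_E (p a m) (p b n) \<longleftrightarrow> (m = Suc n \<or> n = Suc m) \<and> (a = b \<or> m = 0 \<or> n = 0)"
      if "m \<le> len a" "n \<le> len b" for a b m n
      using that by blast
    show "1 < (\<Sum>a\<in>UNIV. 1 / real (len a + 1))"
      using N by (auto simp: sum_3 lens)
    show "(\<forall>a. 0 < len a) \<or> (\<forall>a. a \<noteq> 1 \<longrightarrow> len a = 0)" using N by (auto simp: len_def)
  qed
  then show ?thesis by blast
qed

theorem theorem6p6:
  fixes adj :: "'n::finite graph"
    and X :: "(real ^ 'n) set set"
  assumes "simply_laced_dynkin adj"
    and "X \<in> pair_orbits adj"
  shows "\<exists>\<alpha> \<beta>. {\<alpha>, \<beta>} \<in> X \<and> (\<forall>\<rho>\<in>X. pair_le2 adj \<rho> {\<alpha>, \<beta>}) \<and>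
    (\<forall>\<alpha>' \<beta>' (\<mu> :: real ^ 'n ^ 'n \<Rightarrow> real) (l :: real ^ 'n ^ 'n \<Rightarrow> real).
       {\<alpha>', \<beta>'} \<in> X \<longrightarrow> {\<alpha>', \<beta>'} \<noteq> {\<alpha>, \<beta>} \<longrightarrow>
       \<alpha> \<or>\<^sub>2 \<beta> = (\<Sum>b\<in>canonical_basis adj. \<mu> b *\<^sub>R b) \<longrightarrow>
       \<alpha>' \<or>\<^sub>2 \<beta>' = (\<Sum>b\<in>canonical_basis adj. l b *\<^sub>R b) \<longrightarrow>
       (\<forall>b\<in>canonical_basis adj. l b \<le> \<mu> b))"
proof -
  obtain c arm len where "star_diagram adj c arm len"
    using assms(1) star_A star_D star_E unfolding simply_laced_dynkin_def by blast
  then interpret star_diagram adj c arm len .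
  obtain \<alpha> \<beta> where max: "{\<alpha>, \<beta>} \<in> X" "\<And>\<rho>. \<rho> \<in> X \<Longrightarrow> pair_le2 adj \<rho> {\<alpha>, \<beta>}"
    using orbit_maximum[OF assms(2)] by blast
  show ?thesis
  proof (intro exI conjI allI impI ballI)
    show "{\<alpha>, \<beta>} \<in> X" by (rule max)
    show "pair_le2 adj \<rho> {\<alpha>, \<beta>}" if "\<rho> \<in> X" for \<rho> using that by (rule max)
    fix \<alpha>' \<beta>' \<mu> l b
    assume "{\<alpha>', \<beta>'} \<in> X" "\<alpha> \<or>\<^sub>2 \<beta> = (\<Sum>b\<in>canonical_basis adj. \<mu> b *\<^sub>R b)"
      "\<alpha>' \<or>\<^sub>2 \<beta>' = (\<Sum>b\<in>canonical_basis adj. l b *\<^sub>R b)" "b \<in> canonical_basis adj"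
    then show "l b \<le> \<mu> b" using pair_le2_coefficients max(2) by blast
  qed
qed

end
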